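(* Let $0<\alpha<mn$, let $1<s\le\infty$ with conjugate exponent $s'$ (so $\frac1s+\frac1{s'}=1$) satisfying $1\le s'<\frac{mn}{\alpha}$, and let $\Omega$ be homogeneous of degree zero on $\mathbb{R}^{mn}$ with $\Omega\in L^{s}(S^{mn-1})$. Let $(u,\upsilon)$ be a pair of weights on $\mathbb{R}^n$, let $s'<p_i<q_i<\infty$ for each $i=1,\dots,m$, and let $\frac1p=\frac1{q_1}+\frac1{q_2}+\cdots+\frac1{q_m}$. Suppose that for each $i=1,\dots,m$ there exist $r_i>1$ and a constant $C>0$ such that for every cube $Q$ in $\mathbb{R}^n$, $$|Q|^{\frac{s'}{q_i}+\frac{\alpha s'}{mn}-\frac{s'}{p_i}}\left(\frac1{|Q|}\int_Q u(x)\,dx\right)^{\frac{s'}{q_i}}\left(\frac1{|Q|}\int_Q\upsilon(x)^{r_i\left(1-\left(\frac{p_i}{s'}\right)'\right)}dx\right)^{\frac{1}{r_i\left(\frac{p_i}{s'}\right)'}}\le C.$$ Then there is a constant $C>0$ such that for arbitrary $f_i\in L^{p_i}_{\upsilon}(\mathbb{R}^n)$, $i=1,\dots,m$ (with $C$ independent of the $f_i$), $$\left\|M_{\Omega,\alpha}^{(m)}(\overrightarrow{f})\right\|_{L^{p}_{u}(\mathbb{R}^n)}\le C\prod_{i=1}^m\|f_i\|_{L^{p_i}_{\upsilon}(\mathbb{R}^n)}.$$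
   Context: $n\ge 2$ and $m\ge1$ are integers. Write $\overrightarrow{y}=(y_1,\dots,y_m)\in(\mathbb{R}^n)^m=\mathbb{R}^{mn}$, $d\overrightarrow{y}=dy_1\cdots dy_m$, $|\overrightarrow{y}|=|y_1|+\cdots+|y_m|$, and $\overrightarrow{f}=(f_1,\dots,f_m)$. $S^{mn-1}$ is the unit sphere of $\mathbb{R}^{mn}$ with surface measure. "$\Omega$ is homogeneous of degree zero" means $\Omega(\lambda\overrightarrow{y})=\Omega(\overrightarrow{y})$ for all $\lambda>0$, $\overrightarrow{y}\ne0$. The rough multi-sublinear fractional maximal operator is $$M_{\Omega,\alpha}^{(m)}(\overrightarrow{f})(x)=\sup_{r>0}\frac{1}{r^{mn-\alpha}}\int_{|\overrightarrow{y}|<r}|\Omega(\overrightarrow{y})|\prod_{i=1}^m|f_i(x-y_i)|\,d\overrightarrow{y},\qquad x\in\mathbb{R}^n.$$ A weight is a nonnegative locally integrable function on $\mathbb{R}^n$ that is positive a.e. Cubes have sides parallel to the coordinate axes. For $a>1$, $a'=\frac{a}{a-1}$; in particular $\left(\frac{p_i}{s'}\right)'$ is the conjugate exponent of $\frac{p_i}{s'}$. For a weight $v$ and $0<p<\infty$, $\|g\|_{L^p_v}=\left(\int_{\mathbb{R}^n}|g(x)|^p v(x)\,dx\right)^{1/p}$. *)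

theory Defs
  imports "HOL-Analysis.Analysis"
begin

(* Real powers of extended nonnegative reals; meant for exponents a > 0 only. *)
definition epowr :: "ennreal \<Rightarrow> real \<Rightarrow> ennreal" (infixr "epowr" 80) where
  "x epowr a = (if x = \<infinity> then \<infinity> else ennreal (enn2real x powr a))"

definition conj_exp :: "real \<Rightarrow> real" where
  "conj_exp a = a / (a - 1)"

definition weight :: "('a::euclidean_space \<Rightarrow> real) \<Rightarrow> bool" where
  "weight w \<longleftrightarrow> (\<forall>x. 0 \<le> w x) \<and>
     (\<forall>K. compact K \<longrightarrow> set_integrable lebesgue K w) \<and>
     (AE x in lebesgue. 0 < w x)"

definition cube :: "(real ^ 'n) set \<Rightarrow> bool" where
  "cube Q \<longleftrightarrow> (\<exists>a l. 0 < l \<and> Q = cbox a (a + vec l))"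

definition average :: "'a::euclidean_space set \<Rightarrow> ('a \<Rightarrow> ennreal) \<Rightarrow> ennreal" where
  "average Q g = (1 / emeasure lebesgue Q) * (\<integral>\<^sup>+x\<in>Q. g x \<partial>lebesgue)"

(* The norm of the weighted space over (0, \<infinity>); the argument may take the value \<infinity>,
   as maximal functions do. *)
definition Lp_norm :: "('a::euclidean_space \<Rightarrow> real) \<Rightarrow> real \<Rightarrow> ('a \<Rightarrow> ennreal) \<Rightarrow> ennreal" where
  "Lp_norm v p g = (\<integral>\<^sup>+x. g x epowr p * ennreal (v x) \<partial>lebesgue) epowr (1 / p)"

definition Lp_space :: "('a::euclidean_space \<Rightarrow> real) \<Rightarrow> real \<Rightarrow> ('a \<Rightarrow> complex) set" where
  "Lp_space v p =
     {f \<in> borel_measurable lebesgue. Lp_norm v p (\<lambda>x. ennreal (norm (f x))) < \<infinity>}"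

(* Surface measure on the unit sphere of a d-dimensional space, via polar coordinates:
   a Borel set A has measure d times the volume of the cone {t y | 0 < t <= 1, y in A},
   see emeasure_surface_measure; the measure is then completed. Here sgn y = y / |y|. *)
definition surface_measure :: "'a::euclidean_space measure" where
  "surface_measure = completion (scale_measure (of_nat DIM('a))
     (distr (restrict_space lborel (cball 0 1 - {0})) (restrict_space borel (sphere 0 1)) sgn))"

lemma space_surface_measure: "space surface_measure = sphere 0 1"
  by (simp add: surface_measure_def space_scale_measure space_restrict_space)

lemma emeasure_surface_measure:
  fixes A :: "'a::euclidean_space set"
  assumes "A \<in> sets borel" "A \<subseteq> sphere 0 1"
  shows "emeasure surface_measure A =
    of_nat DIM('a) * emeasure lborel {t *\<^sub>R y | t y. 0 < t \<and> t \<le> 1 \<and> y \<in> A}"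
proof -
  let ?R = "restrict_space lborel (cball 0 1 - {0}) :: 'a measure"
  let ?S = "restrict_space borel (sphere 0 1) :: 'a measure"
  have "sgn \<in> borel_measurable (borel :: 'a measure)"
    unfolding sgn_div_norm[abs_def] by measurable
  then have "sgn \<in> borel_measurable ?R"
    by (intro measurable_restrict_space1) simp
  then have m: "sgn \<in> measurable ?R ?S"
    by (intro measurable_restrict_space2) (auto simp: space_restrict_space norm_sgn)
  have A: "A \<in> sets ?S"
    using assms by (auto simp: sets_restrict_space_iff)
  have eq: "sgn -` A \<inter> space ?R = {t *\<^sub>R y | t y. 0 < t \<and> t \<le> 1 \<and> y \<in> A}"
  proof (intro equalityI subsetI)
    fix x assume "x \<in> sgn -` A \<inter> space ?R"
    then have "x = norm x *\<^sub>R sgn x" "0 < norm x" "norm x \<le> 1" "sgn x \<in> A"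
      by (auto simp: space_restrict_space sgn_div_norm)
    then show "x \<in> {t *\<^sub>R y | t y. 0 < t \<and> t \<le> 1 \<and> y \<in> A}"
      by blast
  next
    fix x assume "x \<in> {t *\<^sub>R y | t y. 0 < t \<and> t \<le> 1 \<and> y \<in> A}"
    then obtain t y where x: "x = t *\<^sub>R y" "0 < t" "t \<le> 1" "y \<in> A" by blast
    moreover have "norm y = 1" using x(4) assms(2) by auto
    ultimately show "x \<in> sgn -` A \<inter> space ?R"
      by (auto simp: space_restrict_space sgn_div_norm)
  qed
  have "emeasure surface_measure A =
      of_nat DIM('a) * emeasure ?R (sgn -` A \<inter> space ?R)"
    unfolding surface_measure_def using A m
    by (subst emeasure_completion) (auto simp: emeasure_distr)
  also have "emeasure ?R (sgn -` A \<inter> space ?R) = emeasure lborel (sgn -` A \<inter> space ?R)"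
    by (rule emeasure_restrict_space) (auto simp: space_restrict_space)
  finally show ?thesis unfolding eq .
qed

definition in_L_sphere :: "ennreal \<Rightarrow> ('a::euclidean_space \<Rightarrow> complex) \<Rightarrow> bool" where
  "in_L_sphere s \<Omega> \<longleftrightarrow> \<Omega> \<in> borel_measurable surface_measure \<and>
     (if s = \<infinity> then \<exists>B. AE y in surface_measure. norm (\<Omega> y) \<le> B
      else (\<integral>\<^sup>+y. ennreal (norm (\<Omega> y) powr enn2real s) \<partial>surface_measure) < \<infinity>)"

definition homogeneous_degree_zero :: "('a::real_vector \<Rightarrow> 'b) \<Rightarrow> bool" where
  "homogeneous_degree_zero \<Omega> \<longleftrightarrow> (\<forall>c>0. \<forall>y. y \<noteq> 0 \<longrightarrow> \<Omega> (c *\<^sub>R y) = \<Omega> y)"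

(* The type real ^ 'n ^ 'm is m-tuples of vectors in n-space; its own norm is the Euclidean
   norm of mn-space (used for the unit sphere), whereas the balls in the maximal operator
   are taken with respect to the sum of the norms of the m components. *)
definition tuple_norm :: "real ^ 'n ^ 'm \<Rightarrow> real" where
  "tuple_norm y = (\<Sum>i\<in>UNIV. norm (y $ i))"

definition rough_frac_maximal ::
  "(real ^ 'n ^ 'm \<Rightarrow> complex) \<Rightarrow> real \<Rightarrow> ('m \<Rightarrow> real ^ 'n \<Rightarrow> complex) \<Rightarrow> real ^ 'n \<Rightarrow> ennreal" where
  "rough_frac_maximal \<Omega> \<alpha> f x =
     (SUP r\<in>{0<..}. ennreal (1 / r powr (real CARD('m) * real CARD('n) - \<alpha>)) *
        (\<integral>\<^sup>+y\<in>{y. tuple_norm y < r}.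
           ennreal (norm (\<Omega> y) * (\<Prod>i\<in>UNIV. norm (f i (x - y $ i)))) \<partial>lebesgue))"

end

theory Submission
  imports Defs
begin

text \<open>
  Hoelder's inequality with exponents \<open>s\<close> and \<open>s'\<close> on the ball of radius \<open>r\<close> removes the kernel,
  whose \<open>s\<close>-th power has integral a multiple of \<open>r^{mn}\<close> there, and splits the remaining integral into
  one factor for each \<open>i\<close>. Covering the balls of radius \<open>r \<sim> 2^k\<close> by dilated dyadic cubes \<open>R\<close>, the
  maximal operator is at most a product of powers of the sums over all cubes \<open>R \<ni> x\<close> of
  \<open>(|R|^\<gamma> avg_R |f_i|^{s'})^{q_i/s'}\<close> with \<open>\<gamma> = \<alpha> s'/(mn)\<close>. Since \<open>\<Sum> p0/q_i = 1\<close>, it remains to bound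
  the \<open>u\<close>-integral of each sum. With \<open>P = p_i/s' < Q = q_i/s'\<close> and \<open>t < P\<close> the conjugate exponent of
  \<open>r_i P'\<close>, the hypothesis on the weights leaves \<open>\<Sum>_R |R|^{Q/P} (avg_R H)^{Q/t}\<close> with
  \<open>H = (|f_i|^{s'} \<upsilon>^{1/P})^t\<close>.

  Because \<open>P < Q\<close> strictly, this sum over all scales converges and no maximal theorem or sparse family is
  needed: for \<open>\<tau> = P/t\<close>, \<open>\<sigma> = Q/t\<close> and \<open>N = \<parallel>H\<parallel>_\<tau>\<close>, the part of \<open>R\<close> where \<open>2 H > avg_R H\<close> carries at
  least half of the integral of \<open>H\<close>, and \<open>avg_R H \<le> |R|^{-1/\<tau>} N\<close>, so that for each \<open>y\<close> the relevant
  \<open>R \<ni> y\<close> contribute a two-sided geometric series of size \<open>N^{\<sigma>-\<tau>} H(y)^\<tau>\<close>.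
\<close>

subsection \<open>Powers of extended nonnegative reals\<close>

lemma ennreal_epowr: "0 \<le> x \<Longrightarrow> ennreal x epowr a = ennreal (x powr a)"
  by (simp add: epowr_def)

lemma top_epowr [simp]: "top epowr a = top"
  by (simp add: epowr_def)

lemma zero_epowr [simp]: "0 epowr a = 0"
  by (simp add: epowr_def)

lemma one_epowr [simp]: "1 epowr a = 1"
  by (simp add: epowr_def)

lemma epowr_one [simp]: "x epowr 1 = x"
  by (cases x) (auto simp: ennreal_epowr)

lemma epowr_eq_0_iff [simp]: "x epowr a = 0 \<longleftrightarrow> x = 0"
  by (cases x) (auto simp: ennreal_epowr ennreal_eq_0_iff)

lemma epowr_mono: "x \<le> y \<Longrightarrow> 0 \<le> a \<Longrightarrow> x epowr a \<le> y epowr a"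
  by (cases x; cases y) (auto simp: ennreal_epowr powr_mono2 top_unique)

lemma epowr_mult_distrib: "0 < a \<Longrightarrow> (x * y) epowr a = x epowr a * y epowr a"
  by (cases x; cases y)
     (auto simp: ennreal_epowr powr_mult ennreal_mult_top ennreal_top_mult ennreal_eq_0_iff
           simp flip: ennreal_mult)

lemma epowr_epowr: "(x epowr a) epowr b = x epowr (a * b)"
  by (cases x) (auto simp: ennreal_epowr powr_powr)

lemma epowr_add: "x epowr (a + b) = x epowr a * x epowr b"
  by (cases x) (auto simp: ennreal_epowr powr_add ennreal_mult)

lemma epowr_prod: "0 < a \<Longrightarrow> (\<Prod>i\<in>I. f i) epowr a = (\<Prod>i\<in>I. f i epowr a)"
  by (induction I rule: infinite_finite_induct) (auto simp: epowr_mult_distrib)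

lemma borel_measurable_epowr [measurable]:
  assumes [measurable]: "f \<in> borel_measurable M"
  shows "(\<lambda>x. f x epowr a) \<in> borel_measurable M"
  unfolding epowr_def by measurable

subsection \<open>Hoelder's inequality for several functions\<close>

text \<open>Convexity of \<open>exp\<close> at the points \<open>ln (y i)\<close>, once zero and
  infinite arguments are set aside: a zero makes the product vanish, and an infinite argument makes
  the sum infinite because its weight is positive.\<close>

lemma weighted_AM_GM_epowr:
  assumes "finite I" "\<And>i. i \<in> I \<Longrightarrow> 0 < w i" "sum w I = 1"
  shows "(\<Prod>i\<in>I. x i epowr w i) \<le> (\<Sum>i\<in>I. ennreal (w i) * x i)"
proof (cases "\<exists>i\<in>I. x i = top")
  case True
  then obtain i where i: "i \<in> I" "x i = top" by blast
  then have "ennreal (w i) * x i = top"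
    using assms(2)[of i] by (simp add: ennreal_mult_top ennreal_eq_0_iff)
  then have "(\<Sum>i\<in>I. ennreal (w i) * x i) = top"
    using i assms(1) by (metis ennreal_sum_eq_top)
  then show ?thesis by simp
next
  case fin: False
  define y where "y i = enn2real (x i)" for i
  have xy: "x i = ennreal (y i)" if "i \<in> I" for i
    using fin that by (auto simp: y_def less_top)
  have y0: "0 \<le> y i" for i by (simp add: y_def)
  have "(\<Prod>i\<in>I. y i powr w i) \<le> (\<Sum>i\<in>I. w i * y i)"
  proof (cases "\<exists>i\<in>I. y i = 0")
    case True
    then have "(\<Prod>i\<in>I. y i powr w i) = 0" using assms(1) by auto
    then show ?thesis using assms(2) y0 by (simp add: sum_nonneg less_imp_le)
  next
    case False
    then have pos: "0 < y i" if "i \<in> I" for i using y0[of i] that by force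
    have "(\<Prod>i\<in>I. y i powr w i) = exp (\<Sum>i\<in>I. w i *\<^sub>R ln (y i))"
      unfolding real_scaleR_def exp_sum[OF assms(1)]
      by (intro prod.cong refl) (use pos in \<open>force simp: powr_def\<close>)
    also have "\<dots> \<le> (\<Sum>i\<in>I. w i * exp (ln (y i)))"
      using assms by (intro convex_on_sum[OF _ _ exp_convex]) (auto intro: less_imp_le)
    also have "\<dots> = (\<Sum>i\<in>I. w i * y i)" using pos by (intro sum.cong) auto
    finally show ?thesis .
  qed
  moreover have "(\<Prod>i\<in>I. x i epowr w i) = ennreal (\<Prod>i\<in>I. y i powr w i)"
    using xy y0 by (simp add: ennreal_epowr prod_ennreal)
  moreover have "(\<Sum>i\<in>I. ennreal (w i) * x i) = ennreal (\<Sum>i\<in>I. w i * y i)"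
    using xy y0 assms(2) by (simp add: less_imp_le flip: ennreal_mult)
  ultimately show ?thesis by (simp add: ennreal_leI)
qed

text \<open>Normalising each \<open>F i\<close> to integral one, the weighted means dominate the
  product pointwise and their integrals add up to one. If some integral is zero, the left side
  vanishes; if none is zero but one is infinite, the right side is infinite.\<close>

lemma nn_integral_prod_epowr_le:
  assumes "finite I" "\<And>i. i \<in> I \<Longrightarrow> 0 < w i" "sum w I = 1"
    and [measurable]: "\<And>i. i \<in> I \<Longrightarrow> F i \<in> borel_measurable M"
  shows "(\<integral>\<^sup>+x. (\<Prod>i\<in>I. F i x epowr w i) \<partial>M) \<le> (\<Prod>i\<in>I. (\<integral>\<^sup>+x. F i x \<partial>M) epowr w i)"
proof -
  let ?a = "\<lambda>i. \<integral>\<^sup>+x. F i x \<partial>M"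
  consider i where "i \<in> I" "?a i = 0" | i where "\<And>i. i \<in> I \<Longrightarrow> ?a i \<noteq> 0" "i \<in> I" "?a i = top"
    | "\<And>i. i \<in> I \<Longrightarrow> ?a i \<noteq> 0 \<and> ?a i \<noteq> top" by blast
  then show ?thesis
  proof cases
    case 1
    then have "AE x in M. F i x = 0" by (simp add: nn_integral_0_iff_AE)
    then have "AE x in M. (\<Prod>i\<in>I. F i x epowr w i) = 0"
      using 1 assms(1) by (auto elim!: eventually_mono simp: prod_zero_iff)
    then have "(\<integral>\<^sup>+x. (\<Prod>i\<in>I. F i x epowr w i) \<partial>M) = (\<integral>\<^sup>+x. 0 \<partial>M)"
      by (rule nn_integral_cong_AE)
    then show ?thesis by simp
  next
    case 2
    then have "?a i epowr w i = top" by simp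
    moreover have "(\<Prod>j\<in>I - {i}. ?a j epowr w j) \<noteq> 0"
      using 2(1) assms(1) by (simp add: prod_zero_iff)
    ultimately have "(\<Prod>i\<in>I. ?a i epowr w i) = top"
      using assms(1) 2(2) by (simp add: prod.remove[of I i])
    then show ?thesis by simp
  next
    case 3
    define G where "G i x = F i x / ?a i" for i x
    have [measurable]: "G i \<in> borel_measurable M" if "i \<in> I" for i
      unfolding G_def using that by measurable
    have F: "F i x = ?a i * G i x" if "i \<in> I" for i x
      using 3[OF that] unfolding G_def
      by (simp add: ennreal_times_divide mult.commute[of "?a i"] ennreal_mult_divide_eq)
    have "(\<integral>\<^sup>+x. (\<Prod>i\<in>I. F i x epowr w i) \<partial>M)
        = (\<integral>\<^sup>+x. (\<Prod>i\<in>I. ?a i epowr w i) * (\<Prod>i\<in>I. G i x epowr w i) \<partial>M)"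
    proof (intro nn_integral_cong)
      fix x
      have "F i x epowr w i = ?a i epowr w i * G i x epowr w i" if "i \<in> I" for i
        by (subst F[OF that]) (rule epowr_mult_distrib[OF assms(2)[OF that]])
      then show "(\<Prod>i\<in>I. F i x epowr w i) = (\<Prod>i\<in>I. ?a i epowr w i) * (\<Prod>i\<in>I. G i x epowr w i)"
        by (simp add: prod.distrib[symmetric])
    qed
    also have "\<dots> = (\<Prod>i\<in>I. ?a i epowr w i) * (\<integral>\<^sup>+x. (\<Prod>i\<in>I. G i x epowr w i) \<partial>M)"
      by (intro nn_integral_cmult borel_measurable_prod_ennreal) measurable
    also have "(\<integral>\<^sup>+x. (\<Prod>i\<in>I. G i x epowr w i) \<partial>M) \<le> (\<integral>\<^sup>+x. (\<Sum>i\<in>I. ennreal (w i) * G i x) \<partial>M)"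
      using assms by (intro nn_integral_mono weighted_AM_GM_epowr) auto
    also have "\<dots> = (\<Sum>i\<in>I. ennreal (w i) * (\<integral>\<^sup>+x. G i x \<partial>M))"
      by (subst nn_integral_sum) (auto intro!: sum.cong nn_integral_cmult)
    also have "\<dots> = (\<Sum>i\<in>I. ennreal (w i))"
      using 3 unfolding G_def by (intro sum.cong) (auto simp: nn_integral_divide less_top)
    also have "\<dots> = 1"
      using assms by (simp add: less_imp_le)
    finally show ?thesis by (simp add: mult_left_mono)
  qed
qed

text \<open>The case of two functions, as a family indexed by \<open>bool\<close>.\<close>

lemma nn_integral_Hoelder:
  assumes "0 < a" "0 < b" "a + b = 1"
    and [measurable]: "F \<in> borel_measurable M" "G \<in> borel_measurable M"
  shows "(\<integral>\<^sup>+x. F x epowr a * G x epowr b \<partial>M)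
     \<le> (\<integral>\<^sup>+x. F x \<partial>M) epowr a * (\<integral>\<^sup>+x. G x \<partial>M) epowr b"
proof -
  have "(\<Prod>c\<in>UNIV. (if c then F else G) x epowr (if c then a else b)) = F x epowr a * G x epowr b" for x
    by (simp add: UNIV_bool mult.commute)
  moreover have "(\<integral>\<^sup>+x. (\<Prod>c\<in>UNIV. (if c then F else G) x epowr (if c then a else b)) \<partial>M)
      \<le> (\<Prod>c\<in>UNIV. (\<integral>\<^sup>+x. (if c then F else G) x \<partial>M) epowr (if c then a else b))"
    by (rule nn_integral_prod_epowr_le) (use assms(1-3) in \<open>auto simp: UNIV_bool add.commute\<close>)
  ultimately show ?thesis
    by (simp add: UNIV_bool mult.commute)
qed

subsection \<open>Lebesgue measure on tuples of vectors\<close>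

lemma Basis_vec_eq_image:
  "(Basis :: ('a::euclidean_space ^ 'm) set) = (\<lambda>(i, b). axis i b) ` (UNIV \<times> Basis)"
  by (auto simp: Basis_vec_def)

lemma inj_on_axis_Basis: "inj_on (\<lambda>(i, b). axis i b :: 'a::euclidean_space ^ 'm) (UNIV \<times> Basis)"
  by (auto simp: inj_on_def axis_eq_axis nonzero_Basis)

lemma prod_Basis_vec:
  "(\<Prod>b\<in>(Basis :: ('a::euclidean_space ^ 'm) set). F b) = (\<Prod>i\<in>UNIV. \<Prod>b\<in>Basis. F (axis i b))"
  unfolding Basis_vec_eq_image
  by (subst prod.reindex[OF inj_on_axis_Basis]) (simp add: prod.cartesian_product split_def)

lemma measurable_vec_lambda_PiM [measurable]:
  "(\<lambda>f. \<chi> i. f i) \<in> borel_measurable (\<Pi>\<^sub>M i\<in>(UNIV::'m::finite set). (lborel :: 'a::euclidean_space measure))"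
  by (subst borel_measurable_euclidean_space) (auto simp: Basis_vec_def inner_axis)

text \<open>Both measures give a box the product of its side lengths, and Lebesgue measure is
  determined by its values on boxes. This lets integrals over tuples be taken one component at a
  time.\<close>

lemma lborel_vec:
  "(lborel :: ('a::euclidean_space ^ 'm) measure) = distr (\<Pi>\<^sub>M i\<in>UNIV. lborel) borel (\<lambda>f. \<chi> i. f i)"
proof (rule lborel_eqI)
  interpret product_sigma_finite "\<lambda>_::'m. lborel :: 'a measure" ..
  fix l u :: "'a ^ 'm"
  assume le: "\<And>b. b \<in> Basis \<Longrightarrow> l \<bullet> b \<le> u \<bullet> b"
  have le': "l $ i \<bullet> b \<le> u $ i \<bullet> b" if "b \<in> Basis" for i b
    using le[of "axis i b"] that by (simp add: inner_axis)
  have "(\<lambda>f. \<chi> i. f i) -` box l u \<inter> space (\<Pi>\<^sub>M i\<in>(UNIV::'m set). (lborel :: 'a measure))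
      = (\<Pi>\<^sub>E i\<in>UNIV. box (l $ i) (u $ i))"
    by (auto simp: box_def Basis_vec_def inner_axis space_PiM PiE_def)
  then have "emeasure (distr (\<Pi>\<^sub>M i\<in>UNIV. lborel) borel (\<lambda>f. \<chi> i. f i)) (box l u)
      = emeasure (\<Pi>\<^sub>M i\<in>UNIV. lborel) (\<Pi>\<^sub>E i\<in>UNIV. box (l $ i) (u $ i))"
    by (subst emeasure_distr) auto
  also have "\<dots> = (\<Prod>i\<in>UNIV. emeasure lborel (box (l $ i) (u $ i)))"
    by (rule emeasure_PiM) auto
  also have "\<dots> = (\<Prod>i\<in>UNIV. ennreal (\<Prod>b\<in>Basis. (u $ i - l $ i) \<bullet> b))"
    using le' by (intro prod.cong refl emeasure_lborel_box)
  also have "\<dots> = ennreal (\<Prod>b\<in>Basis. (u - l) \<bullet> b)"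
    unfolding prod_Basis_vec using le'
    by (subst prod_ennreal) (auto intro!: prod_nonneg simp: inner_axis inner_diff_left)
  finally show "emeasure (distr (\<Pi>\<^sub>M i\<in>UNIV. lborel) borel (\<lambda>f. \<chi> i. f i)) (box l u)
      = (\<Prod>b\<in>Basis. (u - l) \<bullet> b)" .
qed simp

lemma nn_integral_lborel_vec_prod:
  fixes f :: "'m::finite \<Rightarrow> 'a::euclidean_space \<Rightarrow> ennreal"
  assumes [measurable]: "\<And>i. f i \<in> borel_measurable borel"
  shows "(\<integral>\<^sup>+y. (\<Prod>i\<in>UNIV. f i (y $ i)) \<partial>lborel) = (\<Prod>i\<in>UNIV. \<integral>\<^sup>+x. f i x \<partial>lborel)"
proof -
  interpret product_sigma_finite "\<lambda>_::'m. lborel :: 'a measure" ..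
  have [measurable]: "(\<lambda>y::'a^'m. y $ i) \<in> borel_measurable borel" for i
    by (intro borel_measurable_continuous_onI continuous_intros)
  have "(\<integral>\<^sup>+y. (\<Prod>i\<in>UNIV. f i (y $ i)) \<partial>lborel)
      = (\<integral>\<^sup>+x. (\<Prod>i\<in>UNIV. f i (x i)) \<partial>(\<Pi>\<^sub>M i\<in>UNIV. lborel))"
    by (subst lborel_vec, subst nn_integral_distr) auto
  also have "\<dots> = (\<Prod>i\<in>UNIV. \<integral>\<^sup>+x. f i x \<partial>lborel)"
    by (rule product_nn_integral_prod) auto
  finally show ?thesis .
qed

subsection \<open>Measurable majorants\<close>

text \<open>A Borel version agrees with \<open>g\<close> only almost everywhere; raising it to
  \<open>top\<close> on a null set that contains the exceptional points makes it a majorant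
  everywhere. Such a bound survives composition with \<open>sgn\<close> or with a translation and
  projection.\<close>

lemma completion_ex_majorant:
  fixes g :: "'a \<Rightarrow> ennreal"
  assumes "g \<in> borel_measurable (completion M)"
  obtains G where "G \<in> borel_measurable M" "\<And>x. x \<in> space M \<Longrightarrow> g x \<le> G x" "AE x in M. g x = G x"
proof -
  obtain g' where g': "g' \<in> borel_measurable M" "AE x in M. g x = g' x"
    using completion_ex_borel_measurable[OF assms] by blast
  then obtain N where N: "{x \<in> space M. g x \<noteq> g' x} \<subseteq> N" "emeasure M N = 0" "N \<in> sets M"
    by (auto elim: AE_E)
  define G where "G x = (if x \<in> N then top else g' x)" for x
  show thesis
  proof
    show "G \<in> borel_measurable M"
      unfolding G_def using N(3) g'(1) by measurable
    show "g x \<le> G x" if "x \<in> space M" for x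
      using that N(1) by (auto simp: G_def)
    have "N \<in> null_sets M" using N by auto
    then show "AE x in M. g x = G x"
      using g'(2) by (auto simp: G_def dest!: AE_not_in)
  qed
qed

subsection \<open>The rough kernel\<close>

text \<open>The surface measure before its completion, where Borel majorants of the kernel
  live.\<close>

abbreviation sphere_measure :: "'a::euclidean_space measure" where
  "sphere_measure \<equiv> scale_measure (of_nat DIM('a))
     (distr (restrict_space lborel (cball 0 1 - {0})) (restrict_space borel (sphere 0 1)) sgn)"

lemma measurable_sgn_sphere:
  "sgn \<in> restrict_space borel (A - {0}) \<rightarrow>\<^sub>M restrict_space borel (sphere 0 (1::real) :: 'a::euclidean_space set)"
proof -
  have "sgn \<in> borel_measurable (borel :: 'a measure)"
    unfolding sgn_div_norm[abs_def] by measurable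
  then have "sgn \<in> borel_measurable (restrict_space borel (A - {0}) :: 'a measure)"
    by (rule measurable_restrict_space1)
  then show ?thesis
    by (rule measurable_restrict_space2[rotated]) (auto simp: space_restrict_space norm_sgn)
qed

text \<open>The origin gets a value of its own because \<open>sgn 0 = 0\<close> is not on the
  sphere.\<close>

lemma measurable_radial_extension:
  fixes \<phi> :: "'a::euclidean_space \<Rightarrow> ennreal"
  assumes "\<phi> \<in> borel_measurable (restrict_space borel (sphere 0 1))"
  shows "(\<lambda>y. if y = 0 then c else \<phi> (sgn y)) \<in> borel_measurable borel"
proof (rule measurable_If_restrict_space_iff[THEN iffD2], goal_cases)
  case 2
  have "(\<lambda>y. \<phi> (sgn y)) \<in> borel_measurable (restrict_space borel (UNIV - {0::'a}))"
    using measurable_sgn_sphere assms by (rule measurable_compose)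
  moreover have "{x::'a. x \<noteq> 0} = UNIV - {0}" by auto
  ultimately show ?case by simp
qed simp

lemma nn_integral_lborel_scale:
  fixes f :: "'a::euclidean_space \<Rightarrow> ennreal"
  assumes [measurable]: "f \<in> borel_measurable borel" and r: "0 < r"
  shows "(\<integral>\<^sup>+y. f y \<partial>lborel) = ennreal (r ^ DIM('a)) * (\<integral>\<^sup>+y. f (r *\<^sub>R y) \<partial>lborel)"
  using r by (subst lborel_affine[of r 0])
    (auto simp: nn_integral_density nn_integral_distr nn_integral_cmult)

text \<open>Dilation by \<open>r\<close> reduces to the unit ball, where the push-forward of
  Lebesgue measure under \<open>sgn\<close> is the surface measure divided by the dimension; hence
  the factor on the left.\<close>

lemma nn_integral_radial:
  fixes \<phi> :: "'a::euclidean_space \<Rightarrow> ennreal"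
  assumes \<phi>: "\<phi> \<in> borel_measurable (restrict_space borel (sphere 0 1))" and r: "0 < r"
  shows "of_nat DIM('a) * (\<integral>\<^sup>+y\<in>cball 0 r. (if y = 0 then 0 else \<phi> (sgn y)) \<partial>lborel)
    = ennreal (r ^ DIM('a)) * (\<integral>\<^sup>+y. \<phi> y \<partial>sphere_measure)"
proof -
  note [measurable] = measurable_radial_extension[OF \<phi>]
  have [measurable]: "(\<lambda>y::'a. r *\<^sub>R y) \<in> borel_measurable borel"
    by simp
  have "(\<integral>\<^sup>+y\<in>cball 0 r. (if y = 0 then 0 else \<phi> (sgn y)) \<partial>lborel)
      = ennreal (r ^ DIM('a)) *
        (\<integral>\<^sup>+y. (if y = 0 then 0 else \<phi> (sgn y)) * indicator (cball 0 1) y \<partial>lborel)"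
    using r by (subst nn_integral_lborel_scale[OF _ r])
      (auto simp: indicator_def sgn_scaleR intro!: arg_cong2[where f="(*)"] nn_integral_cong)
  also have "(\<integral>\<^sup>+y. (if y = 0 then 0 else \<phi> (sgn y)) * indicator (cball 0 1) y \<partial>lborel)
      = (\<integral>\<^sup>+y. \<phi> (sgn y) * indicator (cball 0 1 - {0}) y \<partial>lborel)"
    by (intro nn_integral_cong) (auto simp: indicator_def)
  also have "\<dots> = (\<integral>\<^sup>+y. \<phi> (sgn y) \<partial>restrict_space lborel (cball 0 1 - {0}))"
    by (subst nn_integral_restrict_space) auto
  also have "\<dots> = (\<integral>\<^sup>+y. \<phi> y \<partial>distr (restrict_space lborel (cball 0 1 - {0}))
      (restrict_space borel (sphere 0 1)) sgn)"
  proof (rule nn_integral_distr[symmetric])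
    show "sgn \<in> restrict_space lborel (cball 0 1 - {0}) \<rightarrow>\<^sub>M restrict_space borel (sphere 0 (1::real) :: 'a set)"
      using measurable_sgn_sphere[of "cball 0 1"]
      by (simp cong: measurable_cong_sets sets_restrict_space_cong)
  qed (use \<phi> in simp)
  finally show ?thesis
    using \<phi> by (simp add: nn_integral_scale_measure mult_ac)
qed

text \<open>The majorant \<open>W\<close> is constant along rays. For finite \<open>s\<close> the
  integral of its \<open>s\<close>-th power over the ball is a multiple of \<open>r ^ d\<close> with
  \<open>d\<close> the dimension, so Hoelder's inequality yields the power
  \<open>d / s = d * (1 - 1 / s')\<close> of \<open>r\<close>. For infinite \<open>s\<close> one has
  \<open>s' = 1\<close>, that power is trivial, and \<open>W\<close> is essentially bounded.\<close>

lemma rough_kernel_Hoelder: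
  fixes \<Omega> :: "'a::euclidean_space \<Rightarrow> complex"
  assumes hom: "homogeneous_degree_zero \<Omega>" and L: "in_L_sphere s \<Omega>"
    and s: "1 < s" "1 / s + 1 / ennreal s' = 1" "1 \<le> s'"
  obtains W c where "W \<in> borel_measurable borel" "\<And>y. ennreal (norm (\<Omega> y)) \<le> W y" "0 < (c::real)"
    "\<And>\<Phi> r. \<Phi> \<in> borel_measurable borel \<Longrightarrow> 0 < r \<Longrightarrow>
       (\<integral>\<^sup>+y\<in>cball 0 r. W y * \<Phi> y \<partial>lborel)
       \<le> ennreal (c * r powr (DIM('a) * (1 - 1 / s'))) * (\<integral>\<^sup>+y\<in>cball 0 r. \<Phi> y epowr s' \<partial>lborel) epowr (1 / s')"
proof -
  have \<Omega>: "(\<lambda>y. ennreal (norm (\<Omega> y))) \<in> borel_measurable (completion sphere_measure)"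
  proof -
    have [measurable]: "\<Omega> \<in> borel_measurable (completion sphere_measure)"
      using L by (simp add: in_L_sphere_def surface_measure_def)
    show ?thesis by measurable
  qed
  have space: "space (sphere_measure :: 'a measure) = sphere 0 1"
    by (simp add: space_scale_measure space_restrict_space)
  obtain G where G: "G \<in> borel_measurable sphere_measure"
    "\<And>y. y \<in> sphere 0 1 \<Longrightarrow> ennreal (norm (\<Omega> y)) \<le> G y"
    "AE y in sphere_measure. ennreal (norm (\<Omega> y)) = G y"
    using completion_ex_majorant[OF \<Omega>] unfolding space by blast
  have Gm [measurable]: "G \<in> borel_measurable (restrict_space borel (sphere 0 1))"
    using G(1) by simp
  \<comment> \<open>Homogeneity does not control \<open>\<Omega> 0\<close>; the value
    \<open>top\<close> keeps the bound there, at the cost of a null set only.\<close>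
  define W where "W y = (if y = 0 then top else G (sgn y))" for y
  have W [measurable]: "W \<in> borel_measurable borel"
    unfolding W_def by (rule measurable_radial_extension[OF Gm])
  have W_ge: "ennreal (norm (\<Omega> y)) \<le> W y" for y
  proof (cases "y = 0")
    case False
    then have "\<Omega> (sgn y) = \<Omega> y"
      using hom unfolding homogeneous_degree_zero_def sgn_div_norm by simp
    then show ?thesis using False G(2)[of "sgn y"] by (simp add: W_def norm_sgn)
  qed (simp add: W_def)
  have [measurable]: "cball (0::'a) r \<in> sets borel" for r
    by simp
  have nz: "AE y in lborel. y \<noteq> (0::'a)"
    by (rule AE_lborel_singleton)
  have d0: "(of_nat DIM('a) :: ennreal) \<noteq> 0" "(of_nat DIM('a) :: ennreal) \<noteq> top"
    by auto
  show thesis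
  proof (cases "s = \<infinity>")
    case True
    have s': "s' = 1"
    proof -
      have "ennreal (1 / s') = ennreal 1"
        using s(2,3) True by (simp add: divide_ennreal[of 1 s', symmetric])
      then show ?thesis using s(3) by (subst (asm) ennreal_inj) auto
    qed
    obtain B where "AE y in surface_measure. norm (\<Omega> y) \<le> B"
      using L True by (auto simp: in_L_sphere_def)
    then have B: "AE y in sphere_measure. norm (\<Omega> y) \<le> B"
      unfolding surface_measure_def by (simp add: AE_completion_iff)
    \<comment> \<open>The maximum makes the constant positive.\<close>
    define b where "b = max B 1"
    have "AE y in sphere_measure. G y \<le> ennreal b"
      using B G(3) by eventually_elim (auto simp: b_def ennreal_leI dest: sym)
    \<comment> \<open>The directions where \<open>G\<close> exceeds \<open>b\<close> form a null set
      of the sphere; the radial formula makes the cone over it null in each ball, and off this cone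
      and the origin \<open>W\<close> is at most \<open>b\<close>.\<close>
    then have "(\<integral>\<^sup>+y. indicator {y. \<not> G y \<le> ennreal b} y \<partial>sphere_measure) = (0::ennreal)"
      by (subst nn_integral_cong_AE[where v="\<lambda>_. 0"]) auto
    moreover have Im: "(\<lambda>y. indicator {y. \<not> G y \<le> ennreal b} y :: ennreal) \<in> borel_measurable (restrict_space borel (sphere 0 1))"
      by measurable
    note Km = measurable_radial_extension[OF Im, of 0]
    note nn_integral_radial[OF Im]
    ultimately have "(\<integral>\<^sup>+y\<in>cball 0 r. (if y = 0 then 0 else indicator {y. \<not> G y \<le> ennreal b} (sgn y)) \<partial>lborel) = 0"
      if "0 < r" for r
      using that d0 by auto
    then have zero: "AE y in lborel. (if y = 0 then 0 else indicator {y. \<not> G y \<le> ennreal b} (sgn y)) * indicator (cball 0 r) y = (0::ennreal)"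
      if "0 < r" for r
      using that by (subst (asm) nn_integral_0_iff_AE)
        (auto intro!: borel_measurable_times_ennreal[OF Km borel_measurable_indicator])
    have AEW: "AE y in lborel. y \<in> cball 0 r \<longrightarrow> W y \<le> ennreal b" if "0 < r" for r
      using zero[OF that] nz by eventually_elim (auto simp: W_def indicator_def split: if_splits)
    show thesis
    proof (rule that[OF W W_ge])
      show "0 < b" by (simp add: b_def)
      fix \<Phi> :: "'a \<Rightarrow> ennreal" and r :: real
      assume [measurable]: "\<Phi> \<in> borel_measurable borel" and r: "0 < r"
      have "(\<integral>\<^sup>+y\<in>cball 0 r. W y * \<Phi> y \<partial>lborel) \<le> (\<integral>\<^sup>+y. ennreal b * (\<Phi> y * indicator (cball 0 r) y) \<partial>lborel)"
        using AEW[OF r] by (intro nn_integral_mono_AE)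
          (auto elim!: eventually_mono simp: indicator_def mult_right_mono)
      also have "\<dots> = ennreal b * (\<integral>\<^sup>+y\<in>cball 0 r. \<Phi> y \<partial>lborel)"
        by (rule nn_integral_cmult) measurable
      finally show "(\<integral>\<^sup>+y\<in>cball 0 r. W y * \<Phi> y \<partial>lborel)
        \<le> ennreal (b * r powr (DIM('a) * (1 - 1 / s'))) * (\<integral>\<^sup>+y\<in>cball 0 r. \<Phi> y epowr s' \<partial>lborel) epowr (1 / s')"
        using r by (simp add: s')
    qed
  next
    case False
    define a where "a = enn2real s"
    have sa: "s = ennreal a" using False by (simp add: a_def less_top)
    have a: "1 < a" using s(1) unfolding sa by (simp add: one_less_ennreal)
    have as: "1 / a + 1 / s' = 1"
    proof -
      have "ennreal (1 / a + 1 / s') = 1 / ennreal a + 1 / ennreal s'"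
        using a s(3) by (simp add: divide_ennreal[of 1, symmetric] ennreal_plus)
      also have "\<dots> = ennreal 1" using s(2) sa by simp
      finally show ?thesis using a s(3) by (subst (asm) ennreal_inj) auto
    qed
    have as': "1 - 1 / s' = 1 / a" using as by linarith
    define I where "I = (\<integral>\<^sup>+y. G y epowr a \<partial>(sphere_measure :: 'a measure))"
    have "I = (\<integral>\<^sup>+y. ennreal (norm (\<Omega> y) powr a) \<partial>sphere_measure)"
      unfolding I_def using G(3)
      by (intro nn_integral_cong_AE) (auto elim!: eventually_mono simp: ennreal_epowr dest: sym)
    also have "\<dots> < top"
      using L False unfolding in_L_sphere_def surface_measure_def a_def
      by (simp add: nn_integral_completion)
    finally have I: "I < top" .
    \<comment> \<open>The summand 1 keeps \<open>c\<close> positive even if the kernel vanishes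
      almost everywhere.\<close>
    define c where "c = enn2real (I / of_nat DIM('a)) powr (1 / a) + 1"
    have WI: "(\<integral>\<^sup>+y\<in>cball 0 r. W y epowr a \<partial>lborel) = ennreal (r ^ DIM('a)) * ennreal (enn2real (I / of_nat DIM('a)))"
      if r: "0 < r" for r
    proof -
      have "(\<integral>\<^sup>+y\<in>cball 0 r. W y epowr a \<partial>lborel)
         = (\<integral>\<^sup>+y\<in>cball 0 r. (if y = 0 then 0 else G (sgn y) epowr a) \<partial>lborel)"
        by (rule nn_integral_cong_AE, use nz in eventually_elim) (simp add: W_def)
      moreover have "of_nat DIM('a) * \<dots> = ennreal (r ^ DIM('a)) * I"
        unfolding I_def by (rule nn_integral_radial[OF _ r]) measurable
      moreover have "ennreal (enn2real (I / of_nat DIM('a))) = I / of_nat DIM('a)"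
        using I by (cases I) (auto simp: ennreal_of_nat_eq_real_of_nat divide_ennreal)
      ultimately show ?thesis
        using d0 ennreal_mult_divide_eq[of "of_nat DIM('a)" "\<integral>\<^sup>+y\<in>cball 0 r. W y epowr a \<partial>lborel"]
        by (simp add: ennreal_times_divide mult.commute[of _ "of_nat DIM('a)"])
    qed
    show thesis
    proof (rule that[OF W W_ge])
      show "0 < c" by (simp add: c_def add_nonneg_pos)
      fix \<Phi> :: "'a \<Rightarrow> ennreal" and r :: real
      assume [measurable]: "\<Phi> \<in> borel_measurable borel" and r: "0 < r"
      have "(\<integral>\<^sup>+y\<in>cball 0 r. W y * \<Phi> y \<partial>lborel)
          = (\<integral>\<^sup>+y. (W y epowr a * indicator (cball 0 r) y) epowr (1 / a)
               * (\<Phi> y epowr s' * indicator (cball 0 r) y) epowr (1 / s') \<partial>lborel)"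
        using a s(3) by (intro nn_integral_cong) (auto simp: indicator_def epowr_epowr)
      also have "\<dots> \<le> (\<integral>\<^sup>+y\<in>cball 0 r. W y epowr a \<partial>lborel) epowr (1 / a)
          * (\<integral>\<^sup>+y\<in>cball 0 r. \<Phi> y epowr s' \<partial>lborel) epowr (1 / s')"
        using a s(3) as by (intro nn_integral_Hoelder) auto
      also have "(\<integral>\<^sup>+y\<in>cball 0 r. W y epowr a \<partial>lborel) epowr (1 / a)
          \<le> ennreal (c * r powr (DIM('a) * (1 - 1 / s')))"
      proof -
        have "(r ^ DIM('a)) powr (1 / a) = r powr (DIM('a) * (1 - 1 / s'))"
          using r by (simp add: powr_realpow[symmetric] powr_powr as')
        then have "(\<integral>\<^sup>+y\<in>cball 0 r. W y epowr a \<partial>lborel) epowr (1 / a)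
          = ennreal (r powr (DIM('a) * (1 - 1 / s')) * enn2real (I / of_nat DIM('a)) powr (1 / a))"
          using r by (simp add: WI ennreal_epowr powr_mult flip: ennreal_mult)
        then show ?thesis by (auto simp: c_def algebra_simps intro!: ennreal_leI)
      qed
      finally show "(\<integral>\<^sup>+y\<in>cball 0 r. W y * \<Phi> y \<partial>lborel)
        \<le> ennreal (c * r powr (DIM('a) * (1 - 1 / s'))) * (\<integral>\<^sup>+y\<in>cball 0 r. \<Phi> y epowr s' \<partial>lborel) epowr (1 / s')"
        by (simp add: mult_right_mono)
    qed
  qed
qed

subsection \<open>A fractional embedding for cube averages\<close>

text \<open>Placing the \<open>n\<close>-th term at both \<open>int n\<close> and
  \<open>- int n\<close> meets every integer, and zero twice, so the two-sided series is at most
  twice the one-sided one.\<close>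

lemma nn_integral_int_geometric:
  assumes r: "0 < r" "r < (1::real)"
  shows "(\<integral>\<^sup>+k. ennreal (r ^ nat \<bar>k\<bar>) \<partial>count_space UNIV) \<le> ennreal (2 / (1 - r))"
proof -
  let ?t = "\<lambda>n k. ennreal (r ^ n) * indicator {int n} k + ennreal (r ^ n) * indicator {- int n} k"
  have "ennreal (r ^ nat \<bar>k\<bar>) \<le> (\<integral>\<^sup>+n. ?t n k \<partial>count_space UNIV)" for k
    using nn_integral_ge_point[of "nat \<bar>k\<bar>" UNIV "\<lambda>n. ?t n k"]
    by (cases "0 \<le> k") (auto simp: indicator_def intro: order_trans[rotated] split: if_splits)
  then have "(\<integral>\<^sup>+k. ennreal (r ^ nat \<bar>k\<bar>) \<partial>count_space UNIV)
      \<le> (\<integral>\<^sup>+k. \<integral>\<^sup>+n. ?t n k \<partial>count_space UNIV \<partial>count_space UNIV)"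
    by (intro nn_integral_mono) simp
  also have "\<dots> = (\<integral>\<^sup>+n. \<integral>\<^sup>+k. ?t n k \<partial>count_space UNIV \<partial>count_space UNIV)"
    by (rule nn_integral_count_space_nn_integral) auto
  also have "\<dots> = (\<integral>\<^sup>+n. 2 * ennreal (r ^ n) \<partial>count_space UNIV)"
    by (intro nn_integral_cong) (simp add: nn_integral_add nn_integral_cmult mult_2)
  also have "\<dots> = (\<Sum>n. 2 * ennreal (r ^ n))"
    by (rule nn_integral_count_space_nat)
  also have "\<dots> = (\<Sum>n. ennreal (2 * r ^ n))"
    using r by (simp add: ennreal_mult')
  also have "\<dots> = ennreal (\<Sum>n. 2 * r ^ n)"
    using r by (intro suminf_ennreal2 summable_mult summable_geometric) auto
  also have "(\<Sum>n. 2 * r ^ n) = 2 / (1 - r)"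
    using r by (subst suminf_mult) (auto simp: suminf_geometric summable_geometric)
  finally show ?thesis .
qed

text \<open>The two powers cross where \<open>z * \<rho> powr k = 1\<close>, and the minimum decays
  geometrically on either side. Changing \<open>z\<close> only shifts the crossing, so the bound is
  uniform in \<open>z\<close>.\<close>

lemma nn_integral_crossover:
  assumes \<rho>: "1 < \<rho>" and a: "0 < a" and c: "0 < (c::real)"
  obtains C where "0 < C" "\<And>z. 0 < z \<Longrightarrow>
    (\<integral>\<^sup>+k. ennreal (min ((z * \<rho> powr real_of_int k) powr a) ((z * \<rho> powr real_of_int k) powr - c))
      \<partial>count_space UNIV) \<le> ennreal C"
proof -
  define d where "d = min a c"
  have d: "0 < d" "d \<le> a" "d \<le> c" using a c by (auto simp: d_def)
  define r where "r = \<rho> powr - d"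
  have r: "0 < r" "r < 1"
    using \<rho> d powr_less_mono[of "-d" 0 \<rho>] by (auto simp: r_def)
  define C where "C = \<rho> powr d * (2 / (1 - r))"
  show thesis
  proof
    show "0 < C" using \<rho> r by (simp add: C_def)
    fix z :: real assume z: "0 < z"
    define L where "L = log \<rho> z"
    have zL: "z * \<rho> powr real_of_int k = \<rho> powr (L + k)" for k
      using z \<rho> by (simp add: L_def powr_add)
    have "min ((z * \<rho> powr real_of_int k) powr a) ((z * \<rho> powr real_of_int k) powr - c)
        \<le> \<rho> powr d * r ^ nat \<bar>\<lfloor>L\<rfloor> + k\<bar>" for k
    proof -
      define y where "y = L + k"
      have "real_of_int \<lfloor>L\<rfloor> \<le> L" "L < real_of_int \<lfloor>L\<rfloor> + 1" by linarith+
      \<comment> \<open>Replacing \<open>log \<rho> z\<close> by its floor moves the crossing by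
        less than one, which is paid for by the factor \<open>\<rho> powr d\<close>.\<close>
      then have y: "\<bar>real_of_int (\<lfloor>L\<rfloor> + k)\<bar> - 1 \<le> \<bar>y\<bar>"
        unfolding y_def of_int_add by linarith
      have "min (\<rho> powr (y * a)) (\<rho> powr (- y * c)) \<le> \<rho> powr (- d * \<bar>y\<bar>)"
      proof (cases "0 \<le> y")
        case True
        then have "\<rho> powr (- y * c) \<le> \<rho> powr (- d * \<bar>y\<bar>)"
          using \<rho> d by (intro powr_mono) (auto intro: mult_right_mono simp: mult.commute)
        then show ?thesis by linarith
      next
        case False
        then have "\<rho> powr (y * a) \<le> \<rho> powr (- d * \<bar>y\<bar>)"
          using \<rho> d by (intro powr_mono) (auto intro: mult_left_mono_neg simp: mult.commute)
        then show ?thesis by linarith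
      qed
      also have "\<dots> \<le> \<rho> powr (d + - d * \<bar>real_of_int (\<lfloor>L\<rfloor> + k)\<bar>)"
        using \<rho> d mult_left_mono[OF y, of d] by (intro powr_mono) (auto simp: algebra_simps)
      also have "\<dots> = \<rho> powr d * r powr real (nat \<bar>\<lfloor>L\<rfloor> + k\<bar>)"
        unfolding r_def powr_powr powr_add by simp
      also have "\<dots> = \<rho> powr d * r ^ nat \<bar>\<lfloor>L\<rfloor> + k\<bar>"
        using r(1) by (simp only: powr_realpow)
      finally show ?thesis unfolding zL y_def[symmetric] powr_powr by simp
    qed
    then have "(\<integral>\<^sup>+k. ennreal (min ((z * \<rho> powr real_of_int k) powr a) ((z * \<rho> powr real_of_int k) powr - c)) \<partial>count_space UNIV)
        \<le> (\<integral>\<^sup>+k. ennreal (\<rho> powr d) * ennreal (r ^ nat \<bar>\<lfloor>L\<rfloor> + k\<bar>) \<partial>count_space UNIV)"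
      using r by (intro nn_integral_mono) (simp add: ennreal_leI flip: ennreal_mult)
    also have "\<dots> = ennreal (\<rho> powr d) * (\<integral>\<^sup>+k. ennreal (r ^ nat \<bar>\<lfloor>L\<rfloor> + k\<bar>) \<partial>count_space UNIV)"
      by (rule nn_integral_cmult) simp
    also have "(\<integral>\<^sup>+k. ennreal (r ^ nat \<bar>\<lfloor>L\<rfloor> + k\<bar>) \<partial>count_space UNIV) = (\<integral>\<^sup>+k. ennreal (r ^ nat \<bar>k\<bar>) \<partial>count_space UNIV)"
      by (rule nn_integral_bij_count_space) (rule bij_betw_byWitness[where f'="\<lambda>k. k - \<lfloor>L\<rfloor>"], auto)
    also have "\<dots> \<le> ennreal (2 / (1 - r))"
      by (rule nn_integral_int_geometric[OF r])
    finally show "(\<integral>\<^sup>+k. ennreal (min ((z * \<rho> powr real_of_int k) powr a) ((z * \<rho> powr real_of_int k) powr - c)) \<partial>count_space UNIV) \<le> ennreal C"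
      using r unfolding C_def by (subst ennreal_mult) (auto simp: mult_left_mono)
  qed
qed

text \<open>The two entries of the minimum agree at \<open>x = (N / g) powr \<tau>\<close>. Measured
  by the ratio of \<open>x\<close> to this size, both branches share one factor in \<open>N\<close>
  and \<open>g\<close>; with all quantities written as exponentials this is linear algebra in the
  exponents.\<close>

lemma crossover_powr:
  fixes x N g \<sigma> \<tau> :: real
  assumes "0 < x" "0 < N" "0 < g" "1 < \<tau>" "\<tau> < \<sigma>"
  shows "x powr (\<sigma> / \<tau> - 1) * min g (x powr (- 1 / \<tau>) * N) powr (\<sigma> - 1)
    \<le> N powr (\<sigma> - \<tau>) * g powr (\<tau> - 1) *
      min ((x / (N / g) powr \<tau>) powr (\<sigma> / \<tau> - 1)) ((x / (N / g) powr \<tau>) powr - (1 - 1 / \<tau>))"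
proof -
  obtain X Y G where e: "x = exp X" "N = exp Y" "g = exp G"
    using assms(1-3) by (metis exp_ln)
  let ?z = "x / (N / g) powr \<tau>"
  have z: "?z = exp (X - \<tau> * (Y - G))"
    by (simp add: e exp_diff[symmetric] exp_powr_real mult.commute)
  have 1: "x powr (\<sigma> / \<tau> - 1) * g powr (\<sigma> - 1) = N powr (\<sigma> - \<tau>) * g powr (\<tau> - 1) * ?z powr (\<sigma> / \<tau> - 1)"
    unfolding z unfolding e using assms(4)
    by (simp add: exp_powr_real exp_add[symmetric] field_simps)
  have 2: "x powr (\<sigma> / \<tau> - 1) * (x powr (- 1 / \<tau>) * N) powr (\<sigma> - 1)
      = N powr (\<sigma> - \<tau>) * g powr (\<tau> - 1) * ?z powr - (1 - 1 / \<tau>)"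
    unfolding z unfolding e using assms(4)
    by (simp add: exp_powr_real exp_add[symmetric] field_simps)
  have "x powr (\<sigma> / \<tau> - 1) * min g (x powr (- 1 / \<tau>) * N) powr (\<sigma> - 1)
      \<le> min (x powr (\<sigma> / \<tau> - 1) * g powr (\<sigma> - 1)) (x powr (\<sigma> / \<tau> - 1) * (x powr (- 1 / \<tau>) * N) powr (\<sigma> - 1))"
    using assms by (auto intro!: mult_left_mono powr_mono2 mult_nonneg_nonneg)
  also have "\<dots> = N powr (\<sigma> - \<tau>) * g powr (\<tau> - 1) * min (?z powr (\<sigma> / \<tau> - 1)) (?z powr - (1 - 1 / \<tau>))"
    unfolding 1 2 by (subst min_mult_distrib_left) auto
  finally show ?thesis .
qed

text \<open>The summand is \<open>|R| powr (\<sigma> / \<tau>)\<close> times the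
  \<open>\<sigma>\<close>-th power of the average of \<open>H\<close> over \<open>R\<close>. After
  each term is turned into an integral over the points where \<open>H\<close> is at least comparable
  to the average, the sum is taken at a fixed point: at most \<open>K\<close> sets count on each
  level, and the crossover bound sums the levels.\<close>

lemma fractional_embedding:
  fixes R :: "int \<Rightarrow> 'j::countable \<Rightarrow> 'a set" and b K \<rho> \<tau> \<sigma> :: real
  assumes R [measurable]: "\<And>k j. R k j \<in> sets M"
    and eR: "\<And>k j. emeasure M (R k j) = ennreal (b * \<rho> powr real_of_int k)"
    and K: "\<And>k y. (\<integral>\<^sup>+j. indicator (R k j) y \<partial>count_space UNIV) \<le> ennreal K"
    and b: "0 < b" and \<rho>: "1 < \<rho>" and K0: "0 < K" and \<tau>: "1 < \<tau>" "\<tau> < \<sigma>"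
  obtains C where "0 < C" "\<And>H. H \<in> borel_measurable M \<Longrightarrow> (\<And>y. 0 \<le> H y) \<Longrightarrow>
    (\<integral>\<^sup>+(k, j). ennreal ((b * \<rho> powr real_of_int k) powr (\<sigma> / \<tau> - \<sigma>)) *
        (\<integral>\<^sup>+y\<in>R k j. ennreal (H y) \<partial>M) epowr \<sigma> \<partial>count_space UNIV)
    \<le> ennreal C * (\<integral>\<^sup>+y. ennreal (H y powr \<tau>) \<partial>M) epowr (\<sigma> / \<tau>)"
proof -
  define a c where "a = \<sigma> / \<tau> - 1" and "c = 1 - 1 / \<tau>"
  have ac: "0 < a" "0 < c" using \<tau> by (auto simp: a_def c_def field_simps)
  obtain C0 where C0: "0 < C0" "\<And>z. 0 < z \<Longrightarrow>
    (\<integral>\<^sup>+k. ennreal (min ((z * \<rho> powr real_of_int k) powr a) ((z * \<rho> powr real_of_int k) powr - c))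
      \<partial>count_space UNIV) \<le> ennreal C0"
    using nn_integral_crossover[OF \<rho> ac] by blast
  \<comment> \<open>\<open>2 powr \<tau>\<close> comes from the threshold \<open>2 * H y\<close>,
    \<open>K\<close> from the overlap within a level and \<open>C0\<close> from the sum over
    levels.\<close>
  define C where "C = 2 powr \<tau> * K * C0"
  have C: "0 < C" using K0 C0 by (simp add: C_def)
  define x where "x k = b * \<rho> powr real_of_int k" for k
  have x: "0 < x k" for k using b \<rho> by (simp add: x_def)
  show thesis
  proof (rule that[OF C])
    fix H :: "'a \<Rightarrow> real"
    assume H [measurable]: "H \<in> borel_measurable M" and H0: "\<And>y. 0 \<le> H y"
    let ?J = "\<integral>\<^sup>+y. ennreal (H y powr \<tau>) \<partial>M"
    let ?I = "\<lambda>k j. \<integral>\<^sup>+y\<in>R k j. ennreal (H y) \<partial>M"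
    show "(\<integral>\<^sup>+(k, j). ennreal ((b * \<rho> powr real_of_int k) powr (\<sigma> / \<tau> - \<sigma>)) * ?I k j epowr \<sigma> \<partial>count_space UNIV)
      \<le> ennreal C * ?J epowr (\<sigma> / \<tau>)"
    proof (cases "?J = top")
      case True
      then show ?thesis using C by simp
    next
      case False
      define N where "N = enn2real ?J powr (1 / \<tau>)"
      have N0: "0 \<le> N" by (simp add: N_def)
      have JN: "?J = ennreal (N powr \<tau>)"
        using False \<tau> by (simp add: N_def powr_powr less_top)
      have I_le: "?I k j \<le> ennreal (x k powr c * N)" for k j
      proof -
        \<comment> \<open>Hoelder's inequality against the indicator of the set; after division by
          \<open>x k\<close> it makes averages over large sets small.\<close>
        have "?I k j = (\<integral>\<^sup>+y. ennreal (H y powr \<tau>) epowr (1 / \<tau>) * indicator (R k j) y epowr c \<partial>M)"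
          using H0 \<tau> by (intro nn_integral_cong) (auto simp: indicator_def ennreal_epowr powr_powr)
        also have "\<dots> \<le> ?J epowr (1 / \<tau>) * (\<integral>\<^sup>+y. indicator (R k j) y \<partial>M) epowr c"
          using \<tau> ac by (intro nn_integral_Hoelder) (auto simp: c_def)
        also have "\<dots> = ennreal (x k powr c * N)"
          using x[of k] N0 \<tau> by (simp add: eR JN x_def[symmetric] ennreal_epowr powr_powr mult.commute flip: ennreal_mult)
        finally show ?thesis .
      qed
      define A where "A k j = enn2real (?I k j) / x k" for k j
      have A0: "0 \<le> A k j" for k j using x[of k] by (simp add: A_def)
      have IA: "?I k j = ennreal (x k * A k j)" for k j
      proof -
        have "?I k j < top" using I_le[of k j] le_less_trans by fastforce
        then show ?thesis using x[of k] by (simp add: A_def)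
      qed
      have AN: "A k j \<le> x k powr (- 1 / \<tau>) * N" for k j
      proof -
        have "x k * A k j \<le> x k powr c * N"
          using I_le[of k j] N0 unfolding IA by (simp add: ennreal_le_iff)
        also have "\<dots> = x k * (x k powr (- 1 / \<tau>) * N)"
          using x[of k] by (simp add: c_def powr_diff powr_minus_divide)
        finally show ?thesis using x[of k] by simp
      qed
      \<comment> \<open>Of the term
        \<open>x k powr (\<sigma> / \<tau>) * A k j powr \<sigma>\<close>, one factor
        \<open>x k * A k j\<close> is written as an integral and the rest stays outside as a
        coefficient.\<close>
      let ?T = "\<lambda>k j y. ennreal (2 * x k powr a * A k j powr (\<sigma> - 1) * H y)
        * indicator {y. A k j < 2 * H y} y * indicator (R k j) y"
      (* At most half of the integral of H over R comes from the points where 2 H <= A. *)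
      have term_le: "ennreal (x k powr (\<sigma> / \<tau> - \<sigma>)) * ?I k j epowr \<sigma> \<le> (\<integral>\<^sup>+y. ?T k j y \<partial>M)" for k j
      proof -
        let ?Z = "\<integral>\<^sup>+y. ennreal (H y) * indicator {y. A k j < 2 * H y} y * indicator (R k j) y \<partial>M"
        have "ennreal (x k * A k j) \<le> (\<integral>\<^sup>+y. ennreal (H y) * indicator {y. A k j < 2 * H y} y * indicator (R k j) y
            + ennreal (A k j / 2) * indicator (R k j) y \<partial>M)"
          unfolding IA[symmetric] by (intro nn_integral_mono) (auto simp: indicator_def intro!: ennreal_leI)
        also have "\<dots> = ?Z + ennreal (A k j / 2) * ennreal (x k)"
          by (subst nn_integral_add) (auto simp: nn_integral_cmult eR x_def)
        also have "\<dots> = ?Z + ennreal (x k * A k j / 2)"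
          using x[of k] A0[of k j] by (simp add: mult.commute flip: ennreal_mult)
        finally have Z: "ennreal (x k * A k j / 2) \<le> ?Z"
        proof (cases ?Z)
          case (real z)
          assume "ennreal (x k * A k j) \<le> ?Z + ennreal (x k * A k j / 2)"
          then show ?thesis using real x[of k] A0[of k j]
            by (simp add: ennreal_le_iff flip: ennreal_plus)
        qed simp
        have "ennreal (x k powr (\<sigma> / \<tau> - \<sigma>)) * ?I k j epowr \<sigma>
            = ennreal (2 * x k powr a * A k j powr (\<sigma> - 1)) * ennreal (x k * A k j / 2)"
          using x[of k] A0[of k j] \<tau> unfolding IA
          by (cases "A k j = 0")
            (auto simp: ennreal_epowr powr_mult a_def powr_diff simp flip: ennreal_mult)
        also have "\<dots> \<le> ennreal (2 * x k powr a * A k j powr (\<sigma> - 1)) * ?Z"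
          by (intro mult_left_mono Z) simp
        also have "\<dots> = (\<integral>\<^sup>+y. ?T k j y \<partial>M)"
          using H0 by (subst nn_integral_cmult[symmetric])
            (auto simp: ennreal_mult mult.assoc intro!: nn_integral_cong)
        finally show ?thesis .
      qed
      have pointwise: "(\<integral>\<^sup>+(k, j). ?T k j y \<partial>count_space UNIV)
          \<le> ennreal (C * N powr (\<sigma> - \<tau>)) * ennreal (H y powr \<tau>)" for y
      \<comment> \<open>If \<open>N = 0\<close> all averages vanish; otherwise, with
        \<open>H y > 0\<close>, the crossing size below is defined and positive.\<close>
      proof (cases "H y = 0 \<or> N = 0")
        case True
        then have "?T k j y = 0" for k j
          using A0[of k j] AN[of k j] \<tau> by (auto simp: indicator_def)
        then show ?thesis by (simp only: split_def) simp
      next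
        case False
        define g where "g = 2 * H y"
        have g: "0 < g" and N: "0 < N" using False H0[of y] N0 by (auto simp: g_def)
        define X where "X = (N / g) powr \<tau>"
        have X: "0 < X" using g N by (simp add: X_def)
        \<comment> \<open>The summand of the crossover bound with \<open>z = b / X\<close>; here
          \<open>X\<close> is the size of set at which Hoelder's bound for the average equals
          \<open>g\<close>.\<close>
        let ?m = "\<lambda>k. min ((b / X * \<rho> powr real_of_int k) powr a) ((b / X * \<rho> powr real_of_int k) powr - c)"
        have T_le: "?T k j y \<le> ennreal (g * N powr (\<sigma> - \<tau>) * g powr (\<tau> - 1)) * (ennreal (?m k) * indicator (R k j) y)" for k j
        proof (cases "A k j < g \<and> y \<in> R k j")
          case True
          have "2 * x k powr a * A k j powr (\<sigma> - 1) * H y = g * (x k powr a * A k j powr (\<sigma> - 1))"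
            by (simp add: g_def)
          \<comment> \<open>The average lies below both \<open>g\<close> and Hoelder's bound, hence
            below their minimum.\<close>
          also have "\<dots> \<le> g * (x k powr a * min g (x k powr (- 1 / \<tau>) * N) powr (\<sigma> - 1))"
            using True AN[of k j] A0[of k j] g \<tau> by (intro mult_left_mono powr_mono2) auto
          also have "\<dots> \<le> g * (N powr (\<sigma> - \<tau>) * g powr (\<tau> - 1) * ?m k)"
            using crossover_powr[OF x N g \<tau>, of k] g
            by (intro mult_left_mono) (auto simp: a_def c_def X_def x_def)
          finally show ?thesis
            using True g by (simp add: g_def[symmetric] ennreal_leI mult.assoc flip: ennreal_mult)
        next
          case False
          then have T0: "?T k j y = 0" by (auto simp: g_def indicator_def)
          show ?thesis by (subst T0) simp
        qed
        have "(\<integral>\<^sup>+(k, j). ?T k j y \<partial>count_space UNIV) = (\<integral>\<^sup>+k. \<integral>\<^sup>+j. ?T k j y \<partial>count_space UNIV \<partial>count_space UNIV)"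
          by (subst nn_integral_fst_count_space[symmetric]) simp
        also have "\<dots> \<le> (\<integral>\<^sup>+k. \<integral>\<^sup>+j. ennreal (g * N powr (\<sigma> - \<tau>) * g powr (\<tau> - 1)) * (ennreal (?m k) * indicator (R k j) y) \<partial>count_space UNIV \<partial>count_space UNIV)"
          by (intro nn_integral_mono T_le)
        also have "\<dots> = ennreal (g * N powr (\<sigma> - \<tau>) * g powr (\<tau> - 1)) * (\<integral>\<^sup>+k. ennreal (?m k) * (\<integral>\<^sup>+j. indicator (R k j) y \<partial>count_space UNIV) \<partial>count_space UNIV)"
          by (simp add: nn_integral_cmult)
        also have "\<dots> \<le> ennreal (g * N powr (\<sigma> - \<tau>) * g powr (\<tau> - 1)) * (\<integral>\<^sup>+k. ennreal (?m k) * ennreal K \<partial>count_space UNIV)"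
          by (intro mult_left_mono nn_integral_mono K) auto
        also have "\<dots> = ennreal (g * N powr (\<sigma> - \<tau>) * g powr (\<tau> - 1)) * ((\<integral>\<^sup>+k. ennreal (?m k) \<partial>count_space UNIV) * ennreal K)"
          by (simp add: nn_integral_multc)
        also have "\<dots> \<le> ennreal (g * N powr (\<sigma> - \<tau>) * g powr (\<tau> - 1)) * (ennreal C0 * ennreal K)"
          using C0(2)[of "b / X"] b X by (intro mult_left_mono mult_right_mono) auto
        also have "\<dots> = ennreal (C * N powr (\<sigma> - \<tau>)) * ennreal (H y powr \<tau>)"
        proof -
          have "g * g powr (\<tau> - 1) = 2 powr \<tau> * H y powr \<tau>"
            using g powr_mult_base[of g "\<tau> - 1"] powr_mult[of 2 "H y" \<tau>] by (simp add: g_def)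
          then have "g * N powr (\<sigma> - \<tau>) * g powr (\<tau> - 1) * (C0 * K) = C * N powr (\<sigma> - \<tau>) * H y powr \<tau>"
            by (simp add: C_def mult_ac)
          then show ?thesis
            using g C0 K0 C by (simp flip: ennreal_mult)
        qed
        finally show ?thesis .
      qed
      have "(\<integral>\<^sup>+(k, j). ennreal (x k powr (\<sigma> / \<tau> - \<sigma>)) * ?I k j epowr \<sigma> \<partial>count_space UNIV)
          \<le> (\<integral>\<^sup>+(k, j). (\<integral>\<^sup>+y. ?T k j y \<partial>M) \<partial>count_space UNIV)"
        using term_le by (intro nn_integral_mono) auto
      also have "\<dots> = (\<integral>\<^sup>+kj. \<integral>\<^sup>+y. (case kj of (k, j) \<Rightarrow> ?T k j y) \<partial>M \<partial>count_space UNIV)"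
        by (intro nn_integral_cong) (auto split: prod.split)
      also have "\<dots> = (\<integral>\<^sup>+y. \<integral>\<^sup>+kj. (case kj of (k, j) \<Rightarrow> ?T k j y) \<partial>count_space UNIV \<partial>M)"
        by (rule nn_integral_count_space_nn_integral[symmetric]) (auto split: prod.split)
      also have "\<dots> \<le> (\<integral>\<^sup>+y. ennreal (C * N powr (\<sigma> - \<tau>)) * ennreal (H y powr \<tau>) \<partial>M)"
        by (intro nn_integral_mono) (use pointwise in simp)
      also have "\<dots> = ennreal (C * N powr (\<sigma> - \<tau>)) * ennreal (N powr \<tau>)"
        by (simp add: nn_integral_cmult JN)
      \<comment> \<open>The powers of \<open>N\<close> add up to \<open>N powr \<sigma>\<close>,
        which is \<open>?J\<close> to the power \<open>\<sigma> / \<tau>\<close>.\<close>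
      also have "\<dots> = ennreal C * ?J epowr (\<sigma> / \<tau>)"
        using C \<tau> by (simp add: JN ennreal_epowr powr_powr mult.assoc flip: ennreal_mult powr_add)
      finally show ?thesis by (simp only: x_def)
    qed
  qed
qed

subsection \<open>Overlapping grid cubes\<close>

(* The cube of the dyadic grid of side 2^k with index j, dilated by 3 about its centre. *)
definition grid_cube :: "int \<Rightarrow> int ^ 'n \<Rightarrow> (real ^ 'n) set" where
  "grid_cube k j = (let a = (\<chi> i. (real_of_int (j $ i) - 1) * 2 powr real_of_int k)
     in cbox a (a + vec (3 * 2 powr real_of_int k)))"

lemma cube_grid_cube: "cube (grid_cube k j)"
  unfolding cube_def grid_cube_def Let_def
  by (rule exI, rule exI[where x="3 * 2 powr real_of_int k"], rule conjI) (simp, rule refl)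

lemma mem_grid_cube:
  "x \<in> grid_cube k j \<longleftrightarrow> (\<forall>i. (real_of_int (j $ i) - 1) * 2 powr real_of_int k \<le> x $ i \<and>
     x $ i \<le> (real_of_int (j $ i) + 2) * 2 powr real_of_int k)"
  unfolding grid_cube_def Let_def mem_box_cart by (auto simp: algebra_simps)

lemma grid_cube_lebesgue [measurable]: "grid_cube k j \<in> sets lebesgue"
  by (simp add: grid_cube_def Let_def)

lemma measure_grid_cube:
  fixes j :: "int ^ 'n"
  shows "measure lebesgue (grid_cube k j) = (3 * 2 powr real_of_int k) ^ CARD('n)"
    and "emeasure lebesgue (grid_cube k j) = ennreal ((3 * 2 powr real_of_int k) ^ CARD('n))"
proof -
  let ?l = "3 * 2 powr real_of_int k"
  have "emeasure lborel (cbox a (a + vec ?l)) = ennreal (?l ^ CARD('n))" for a :: "real ^ 'n"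
    unfolding emeasure_lborel_cbox_eq prod_Basis_vec by (auto simp: Basis_vec_def inner_axis vec_def)
  then show e: "emeasure lebesgue (grid_cube k j) = ennreal (?l ^ CARD('n))"
    by (simp add: grid_cube_def Let_def emeasure_completion)
  show "measure lebesgue (grid_cube k j) = ?l ^ CARD('n)"
    by (simp add: measure_def e)
qed

text \<open>If a dilated cube contains \<open>y\<close>, its index differs from that of the grid
  cell of \<open>y\<close> by at most 2 in each coordinate. The finite set \<open>E\<close> of such
  offsets depends on neither the scale nor the point.\<close>

lemma grid_cube_overlap:
  obtains K where "0 < K"
    "\<And>k y. (\<integral>\<^sup>+j. indicator (grid_cube k j) (y :: real ^ 'n) \<partial>count_space UNIV) \<le> ennreal K"
proof -
  define E where "E = (\<lambda>f. (\<chi> i. f i) :: int ^ 'n) ` (PiE (UNIV :: 'n set) (\<lambda>_. {-2..2}))"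
  have finE: "finite E" unfolding E_def by (intro finite_imageI finite_PiE) auto
  show thesis
  proof
    show "0 < real (card E) + 1" by simp
    fix k :: int and y :: "real ^ 'n"
    define m where "m = (\<chi> i. \<lfloor>y $ i / 2 powr real_of_int k\<rfloor>)"
    have "{j. y \<in> grid_cube k j} \<subseteq> (\<lambda>e. m + e) ` E"
    proof
      fix j assume "j \<in> {j. y \<in> grid_cube k j}"
      then have j: "real_of_int (j $ i) - 1 \<le> y $ i / 2 powr real_of_int k"
        "y $ i / 2 powr real_of_int k \<le> real_of_int (j $ i) + 2" for i
        by (auto simp: mem_grid_cube field_simps)
      have "(j - m) $ i \<in> {-2..2}" for i
        using j[of i] unfolding m_def vector_minus_component vec_lambda_beta atLeastAtMost_iff by linarith
      then have "j - m \<in> E"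
        unfolding E_def by (intro image_eqI[where x="\<lambda>i. (j - m) $ i"]) (auto simp: vec_eq_iff)
      then show "j \<in> (\<lambda>e. m + e) ` E" by (intro image_eqI[where x="j - m"]) auto
    qed
    then have c: "finite {j. y \<in> grid_cube k j}" "card {j. y \<in> grid_cube k j} \<le> card E"
      using finE by (auto intro: finite_subset surj_card_le)
    have "(\<integral>\<^sup>+j. indicator (grid_cube k j) y \<partial>count_space UNIV)
        = (\<integral>\<^sup>+j. indicator {j. y \<in> grid_cube k j} j \<partial>count_space UNIV)"
      by (intro nn_integral_cong) (simp add: indicator_def)
    also have "\<dots> = ennreal (card {j. y \<in> grid_cube k j})"
      using c by (simp add: ennreal_of_nat_eq_real_of_nat)
    also have "\<dots> \<le> ennreal (real (card E) + 1)"
      using c by (intro ennreal_leI) auto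
    finally show "(\<integral>\<^sup>+j. indicator (grid_cube k j) y \<partial>count_space UNIV) \<le> ennreal (real (card E) + 1)" .
  qed
qed

text \<open>Take the least \<open>k\<close> with \<open>r \<le> 2 powr k\<close> and the cell that
  contains the centre. The ball reaches no further than the neighbouring cells, which the dilation
  by 3 covers.\<close>

lemma cball_subset_grid_cube:
  fixes x :: "real ^ 'n"
  assumes r: "0 < r"
  obtains k j where "cball x r \<subseteq> grid_cube k j" "2 powr real_of_int k \<le> 2 * r"
proof
  define k where "k = \<lceil>log 2 r\<rceil>"
  define l where "l = 2 powr real_of_int k"
  define j :: "int ^ 'n" where "j = (\<chi> i. \<lfloor>x $ i / l\<rfloor>)"
  have l: "0 < l" by (simp add: l_def)
  have "r = 2 powr log 2 r" using r by simp
  also have "\<dots> \<le> l" unfolding l_def k_def by (intro powr_mono) auto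
  finally have rl: "r \<le> l" .
  have "real_of_int k \<le> 1 + log 2 r" unfolding k_def by linarith
  then have "l \<le> 2 powr (1 + log 2 r)" unfolding l_def by (intro powr_mono) auto
  also have "\<dots> = 2 * r" using r by (simp add: powr_add)
  finally show "2 powr real_of_int k \<le> 2 * r" by (simp add: l_def)
  show "cball x r \<subseteq> grid_cube k j"
  proof
    fix y assume "y \<in> cball x r"
    then have "\<bar>x $ i - y $ i\<bar> \<le> l" for i
      using component_le_norm_cart[of "x - y" i] rl by (simp add: dist_norm)
    then have y: "x $ i - l \<le> y $ i" "y $ i \<le> x $ i + l" for i
      by (simp_all add: abs_le_iff algebra_simps)
    have x: "real_of_int (j $ i) * l \<le> x $ i" "x $ i \<le> (real_of_int (j $ i) + 1) * l" for i
    proof -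
      have "real_of_int (j $ i) \<le> x $ i / l" "x $ i / l \<le> real_of_int (j $ i) + 1"
        unfolding j_def vec_lambda_beta by linarith+
      then show "real_of_int (j $ i) * l \<le> x $ i" "x $ i \<le> (real_of_int (j $ i) + 1) * l"
        using l by (simp_all add: field_simps)
    qed
    show "y \<in> grid_cube k j"
      unfolding mem_grid_cube l_def[symmetric]
    proof (intro allI conjI)
      fix i
      show "(real_of_int (j $ i) - 1) * l \<le> y $ i" "y $ i \<le> (real_of_int (j $ i) + 2) * l"
        using x[of i] y[of i] by (simp_all add: algebra_simps)
    qed
  qed
qed

subsection \<open>The two-weight estimate on grid cubes\<close>

text \<open>Local integrability gives measurability on each ball, and the weight is the limit of its
  restrictions to growing balls.\<close>

lemma weight_measurable:
  assumes "weight w"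
  shows "w \<in> borel_measurable lebesgue"
proof (rule borel_measurable_LIMSEQ_real)
  fix x :: 'a
  obtain n0 :: nat where n0: "norm x \<le> real n0" using real_arch_simple by blast
  show "(\<lambda>n. indicator (cball 0 (real n)) x *\<^sub>R w x) \<longlonglongrightarrow> w x"
  proof (rule tendsto_eventually, rule eventually_sequentiallyI)
    fix n assume "n0 \<le> n"
    then show "indicator (cball 0 (real n)) x *\<^sub>R w x = w x" using n0 by auto
  qed
next
  fix n :: nat
  show "(\<lambda>x. indicator (cball 0 (real n)) x *\<^sub>R w x) \<in> borel_measurable lebesgue"
    using assms by (auto simp: weight_def set_integrable_def dest!: spec[of _ "cball 0 (real n)"])
qed

lemma borel_measurable_nn_integral_count_space:
  fixes f :: "'i::countable \<Rightarrow> 'a \<Rightarrow> ennreal"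
  assumes "\<And>i. f i \<in> borel_measurable M"
  shows "(\<lambda>x. \<integral>\<^sup>+i. f i x \<partial>count_space UNIV) \<in> borel_measurable M"
proof -
  interpret sigma_finite_measure "count_space (UNIV :: 'i set)"
    by (rule sigma_finite_measure_count_space)
  have "(\<lambda>(i, x). f i x) \<in> borel_measurable (count_space UNIV \<Otimes>\<^sub>M M)"
    using assms by (intro measurable_pair_measure_countable1) auto
  then have "(\<lambda>(x, i). f i x) \<in> borel_measurable (M \<Otimes>\<^sub>M count_space UNIV)"
    by (subst measurable_pair_swap_iff) (simp add: split_def)
  then show ?thesis by (rule borel_measurable_nn_integral)
qed

abbreviation (input) cube_term ::
    "real \<Rightarrow> real \<Rightarrow> (real ^ 'n \<Rightarrow> real) \<Rightarrow> (real ^ 'n) set \<Rightarrow> ennreal" where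
  "cube_term \<gamma> Q g R \<equiv> (ennreal (measure lebesgue R powr \<gamma>) * average R (\<lambda>y. ennreal (g y))) epowr Q"

text \<open>A substitute for the \<open>Q\<close>-th power of the fractional maximal function over
  grid cubes: it dominates each term, and unlike a supremum it can be integrated term by
  term.\<close>

definition grid_sum :: "real \<Rightarrow> real \<Rightarrow> (real ^ 'n \<Rightarrow> real) \<Rightarrow> real ^ 'n \<Rightarrow> ennreal" where
  "grid_sum \<gamma> Q g x = (\<integral>\<^sup>+(k, j). cube_term \<gamma> Q g (grid_cube k j) * indicator (grid_cube k j) x \<partial>count_space UNIV)"

lemma grid_sum_measurable [measurable]: "grid_sum \<gamma> Q g \<in> borel_measurable lebesgue"
  unfolding grid_sum_def[abs_def]
  by (rule borel_measurable_nn_integral_count_space) (auto split: prod.split)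

lemma grid_sum_ge: "x \<in> grid_cube k j \<Longrightarrow> cube_term \<gamma> Q g (grid_cube k j) \<le> grid_sum \<gamma> Q g x"
  unfolding grid_sum_def
  using nn_integral_ge_point[of "(k, j)" UNIV
      "\<lambda>(k, j). cube_term \<gamma> Q g (grid_cube k j) * indicator (grid_cube k j) x"]
  by simp

lemma average_eq:
  assumes "emeasure lebesgue R = ennreal x" "0 < x"
  shows "average R g = ennreal (1 / x) * (\<integral>\<^sup>+y\<in>R. g y \<partial>lebesgue)"
  using assms by (simp add: average_def divide_ennreal[of 1 x, symmetric])

(* The exponent t is conjugate to r P', and Hoelder's inequality is applied with this pair. *)
lemma average_le_bump:
  fixes v g :: "real ^ 'n \<Rightarrow> real"
  assumes R [measurable]: "R \<in> sets lebesgue" and x: "emeasure lebesgue R = ennreal x" "0 < x"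
    and v: "weight v" and P: "1 < P" and r: "1 < r"
    and g [measurable]: "g \<in> borel_measurable lebesgue" and g0: "\<And>y. 0 \<le> g y"
    and t: "1 / t = 1 - 1 / (r * conj_exp P)" "0 < t"
  shows "average R (\<lambda>y. ennreal (g y))
    \<le> average R (\<lambda>y. ennreal (g y powr t * v y powr (t / P))) epowr (1 / t) *
      average R (\<lambda>y. ennreal (v y powr (r * (1 - conj_exp P)))) epowr (1 / (r * conj_exp P))"
proof -
  note [measurable] = weight_measurable[OF v]
  define w where "w = 1 / (r * conj_exp P)"
  have P': "1 < conj_exp P" "1 - conj_exp P = - conj_exp P / P"
    using P by (auto simp: conj_exp_def field_simps)
  have w: "0 < w" using r P' by (simp add: w_def)
  have tw: "1 / t + w = 1" using t(1) by (simp add: w_def)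
  \<comment> \<open>The negative power of \<open>v\<close> from the second factor cancels the
    \<open>v powr (1 / P)\<close> from the first, wherever \<open>v\<close> is positive.\<close>
  have e: "r * (1 - conj_exp P) * w = - 1 / P"
    using r P' P unfolding w_def P'(2) by simp
  have vpos: "AE y in lebesgue. 0 < v y" using v by (simp add: weight_def)
  have "(\<integral>\<^sup>+y\<in>R. ennreal (g y) \<partial>lebesgue)
      = (\<integral>\<^sup>+y. (ennreal (g y powr t * v y powr (t / P)) * indicator R y) epowr (1 / t) *
          (ennreal (v y powr (r * (1 - conj_exp P))) * indicator R y) epowr w \<partial>lebesgue)"
  proof (rule nn_integral_cong_AE, use vpos in eventually_elim)
    fix y assume y: "0 < v y"
    have "(g y powr t * v y powr (t / P)) powr (1 / t) * (v y powr (r * (1 - conj_exp P))) powr w = g y"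
      using y g0[of y] t(2) by (simp add: powr_mult powr_powr e flip: powr_add)
    then show "ennreal (g y) * indicator R y = (ennreal (g y powr t * v y powr (t / P)) * indicator R y) epowr (1 / t) *
          (ennreal (v y powr (r * (1 - conj_exp P))) * indicator R y) epowr w"
      by (simp add: indicator_def ennreal_epowr flip: ennreal_mult)
  qed
  also have "\<dots> \<le> (\<integral>\<^sup>+y\<in>R. ennreal (g y powr t * v y powr (t / P)) \<partial>lebesgue) epowr (1 / t) *
      (\<integral>\<^sup>+y\<in>R. ennreal (v y powr (r * (1 - conj_exp P))) \<partial>lebesgue) epowr w" (is "_ \<le> ?A epowr _ * ?B epowr _")
    using t(2) w tw by (intro nn_integral_Hoelder) auto
  finally have "average R (\<lambda>y. ennreal (g y)) \<le> ennreal (1 / x) * (?A epowr (1 / t) * ?B epowr w)"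
    unfolding average_eq[OF x] by (intro mult_left_mono) auto
  \<comment> \<open>The exponents sum to one, so the normalisation splits into the normalisations of
    the two averages.\<close>
  also have "ennreal (1 / x) = ennreal (1 / x) epowr (1 / t) * ennreal (1 / x) epowr w"
    by (simp add: tw flip: epowr_add)
  finally show ?thesis
    unfolding average_eq[OF x] w_def[symmetric] using t(2) w by (simp add: epowr_mult_distrib mult_ac)
qed

text \<open>On each cube the bump inequality and the hypothesis bound the term by
  \<open>|R| powr (Q / P)\<close> times the average of \<open>H\<close> to the power
  \<open>Q / t\<close>. These are the terms of the fractional embedding with
  \<open>\<tau> = P / t\<close> and \<open>\<sigma> = Q / t\<close>.\<close>

lemma grid_sum_two_weight:
  fixes u v :: "real ^ 'n \<Rightarrow> real"
  assumes u: "weight u" and v: "weight v" and P: "1 < P" "P < Q" and r: "1 < r" and C: "0 < C"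
    and cond: "\<And>R. cube R \<Longrightarrow>
      ennreal (measure lebesgue R powr (1 / Q + \<gamma> - 1 / P)) * average R (\<lambda>x. ennreal (u x)) epowr (1 / Q) *
      average R (\<lambda>x. ennreal (v x powr (r * (1 - conj_exp P)))) epowr (1 / (r * conj_exp P)) \<le> ennreal C"
  obtains C' where "0 < C'" "\<And>g. g \<in> borel_measurable lebesgue \<Longrightarrow> (\<And>y. 0 \<le> g y) \<Longrightarrow>
    (\<integral>\<^sup>+x. grid_sum \<gamma> Q g x * ennreal (u x) \<partial>lebesgue)
    \<le> ennreal C' * (\<integral>\<^sup>+x. ennreal (g x powr P * v x) \<partial>lebesgue) epowr (Q / P)"
proof -
  note [measurable] = weight_measurable[OF u] weight_measurable[OF v]
  have v0: "0 \<le> v y" for y using v by (simp add: weight_def)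
  have P': "1 < conj_exp P" "1 / conj_exp P = 1 - 1 / P"
    using P by (auto simp: conj_exp_def field_simps)
  define t where "t = 1 / (1 - 1 / (r * conj_exp P))"
  \<comment> \<open>As \<open>r > 1\<close>, the conjugate \<open>t\<close> of
    \<open>r * conj_exp P\<close> lies strictly below \<open>P\<close>, the conjugate of
    \<open>conj_exp P\<close>; this gives \<open>1 < \<tau>\<close>.\<close>
  have "1 / (r * conj_exp P) < 1 / conj_exp P"
    using r P' by (intro divide_strict_left_mono) auto
  then have t: "1 / t = 1 - 1 / (r * conj_exp P)" "1 / P < 1 / t"
    using P' by (simp_all add: t_def)
  have t0: "0 < t" using t(2) P(1) by (metis less_trans zero_less_divide_1_iff zero_less_one)
  define \<tau> \<sigma> where "\<tau> = P / t" and "\<sigma> = Q / t"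
  have "t < P" using t(2) t0 P by (simp add: field_simps)
  then have \<tau>: "1 < \<tau>" "\<tau> < \<sigma>" using P t0 by (auto simp: \<tau>_def \<sigma>_def field_simps)
  obtain K where K: "0 < K"
    "\<And>k y. (\<integral>\<^sup>+j. indicator (grid_cube k j) (y :: real ^ 'n) \<partial>count_space UNIV) \<le> ennreal K"
    using grid_cube_overlap by blast
  define b \<rho> :: real where "b = 3 ^ CARD('n)" and "\<rho> = 2 ^ CARD('n)"
  have b: "0 < b" and \<rho>: "1 < \<rho>" by (auto simp: b_def \<rho>_def)
  define X where "X k = b * \<rho> powr real_of_int k" for k
  have X: "0 < X k" for k using b \<rho> by (simp add: X_def)
  have size: "(3 * 2 powr real_of_int k) ^ CARD('n) = X k" for k
  proof -
    have "(2 powr real_of_int k) ^ CARD('n) = (2 powr real_of_int k) powr real CARD('n)"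
      by (rule powr_realpow[symmetric]) simp
    also have "\<dots> = (2 powr real CARD('n)) powr real_of_int k"
      by (simp only: powr_powr mult.commute)
    also have "\<dots> = \<rho> powr real_of_int k"
      by (simp add: \<rho>_def powr_realpow)
    finally show ?thesis by (simp add: X_def b_def power_mult_distrib)
  qed
  have meas: "measure lebesgue (grid_cube k j) = X k" "emeasure lebesgue (grid_cube k j) = ennreal (X k)"
    for k and j :: "int ^ 'n"
    by (simp_all only: measure_grid_cube size)
  obtain C1 where C1: "0 < C1" "\<And>H. H \<in> borel_measurable lebesgue \<Longrightarrow> (\<And>y. 0 \<le> H y) \<Longrightarrow>
    (\<integral>\<^sup>+(k, j). ennreal ((b * \<rho> powr real_of_int k) powr (\<sigma> / \<tau> - \<sigma>)) *
        (\<integral>\<^sup>+y\<in>grid_cube k (j :: int ^ 'n). ennreal (H y) \<partial>lebesgue) epowr \<sigma> \<partial>count_space UNIV)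
    \<le> ennreal C1 * (\<integral>\<^sup>+y. ennreal (H y powr \<tau>) \<partial>lebesgue) epowr (\<sigma> / \<tau>)"
    by (rule fractional_embedding[OF grid_cube_lebesgue meas(2)[unfolded X_def] K(2) b \<rho> K(1) \<tau>]) blast
  show thesis
  proof
    show "0 < C powr Q * C1" using C C1 by simp
    fix g :: "real ^ 'n \<Rightarrow> real"
    assume g [measurable]: "g \<in> borel_measurable lebesgue" and g0: "\<And>y. 0 \<le> g y"
    define H where "H y = g y powr t * v y powr (t / P)" for y
    have H [measurable]: "H \<in> borel_measurable lebesgue" unfolding H_def by measurable
    have H0: "0 \<le> H y" for y by (simp add: H_def)
    \<comment> \<open>Since \<open>(t / P) * \<tau> = 1\<close>, the weight reappears with exponent
      one.\<close>
    have H\<tau>: "H y powr \<tau> = g y powr P * v y" for y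
      using P t0 v0[of y] by (simp add: H_def \<tau>_def powr_mult powr_powr)
    have bound: "cube_term \<gamma> Q g (grid_cube k j) * (\<integral>\<^sup>+x\<in>grid_cube k j. ennreal (u x) \<partial>lebesgue)
        \<le> ennreal (C powr Q) * (ennreal (X k powr (\<sigma> / \<tau> - \<sigma>)) * (\<integral>\<^sup>+y\<in>grid_cube k j. ennreal (H y) \<partial>lebesgue) epowr \<sigma>)"
      for k and j :: "int ^ 'n"
    proof -
      let ?R = "grid_cube k j"
      let ?U = "average ?R (\<lambda>x. ennreal (u x))"
      let ?V = "average ?R (\<lambda>x. ennreal (v x powr (r * (1 - conj_exp P)))) epowr (1 / (r * conj_exp P))"
      let ?h = "average ?R (\<lambda>y. ennreal (H y)) epowr (1 / t)"
      have Q: "0 < Q" using P by simp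
      have "ennreal (X k powr \<gamma>) * average ?R (\<lambda>y. ennreal (g y)) * ?U epowr (1 / Q)
          \<le> ennreal (X k powr \<gamma>) * (?h * ?V) * ?U epowr (1 / Q)"
        unfolding H_def
        by (intro mult_left_mono mult_right_mono average_le_bump[OF _ meas(2) X v P(1) r g g0 t(1) t0]) auto
      \<comment> \<open>Splitting off this power of the size isolates the quantity that the
        hypothesis bounds.\<close>
      also have "\<dots> = ennreal (X k powr (1 / P - 1 / Q)) * ?h *
          (ennreal (X k powr (1 / Q + \<gamma> - 1 / P)) * ?U epowr (1 / Q) * ?V)"
      proof -
        have "ennreal (X k powr \<gamma>) = ennreal (X k powr (1 / P - 1 / Q)) * ennreal (X k powr (1 / Q + \<gamma> - 1 / P))"
          using X[of k] by (simp flip: ennreal_mult powr_add)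
        then show ?thesis by (simp only: mult_ac)
      qed
      also have "\<dots> \<le> ennreal (X k powr (1 / P - 1 / Q)) * ?h * ennreal C"
        using cond[OF cube_grid_cube, of k j] unfolding meas(1) by (intro mult_left_mono) auto
      finally have "(ennreal (X k powr \<gamma>) * average ?R (\<lambda>y. ennreal (g y)) * ?U epowr (1 / Q)) epowr Q
          \<le> (ennreal (X k powr (1 / P - 1 / Q)) * ?h * ennreal C) epowr Q"
        using Q by (intro epowr_mono) auto
      then have "cube_term \<gamma> Q g ?R * ?U
          \<le> ennreal (X k powr (Q / P - 1)) * average ?R (\<lambda>y. ennreal (H y)) epowr \<sigma> * ennreal (C powr Q)"
        using Q C X[of k] unfolding meas(1)
        by (simp add: epowr_mult_distrib epowr_epowr ennreal_epowr powr_powr \<sigma>_def algebra_simps)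
      \<comment> \<open>The factor \<open>X k\<close> turns the average of \<open>u\<close> into its
        integral and raises the exponent \<open>Q / P - 1\<close> to \<open>Q / P\<close>.\<close>
      then have "ennreal (X k) * (cube_term \<gamma> Q g ?R * ?U)
          \<le> ennreal (X k) * (ennreal (X k powr (Q / P - 1)) * average ?R (\<lambda>y. ennreal (H y)) epowr \<sigma> * ennreal (C powr Q))"
        by (intro mult_left_mono) auto
      moreover have "ennreal (X k) * (cube_term \<gamma> Q g ?R * ?U) = cube_term \<gamma> Q g ?R * (\<integral>\<^sup>+x\<in>?R. ennreal (u x) \<partial>lebesgue)"
      proof -
        have "ennreal (X k) * ennreal (1 / X k) = 1"
          using X[of k] by (simp flip: ennreal_mult)
        then have "ennreal (X k) * ?U = (\<integral>\<^sup>+x\<in>?R. ennreal (u x) \<partial>lebesgue)"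
          unfolding average_eq[OF meas(2) X] mult.assoc[symmetric] by simp
        then show ?thesis by (simp only: mult.left_commute[of "ennreal (X k)"])
      qed
      moreover have "ennreal (X k) * (ennreal (X k powr (Q / P - 1)) * average ?R (\<lambda>y. ennreal (H y)) epowr \<sigma> * ennreal (C powr Q))
          = ennreal (C powr Q) * (ennreal (X k powr (\<sigma> / \<tau> - \<sigma>)) * (\<integral>\<^sup>+y\<in>?R. ennreal (H y) \<partial>lebesgue) epowr \<sigma>)"
      proof -
        have "X k * (X k powr (Q / P - 1) * (1 / X k) powr \<sigma>) = X k powr (\<sigma> / \<tau> - \<sigma>)"
        proof -
          have "\<sigma> / \<tau> = Q / P" using t0 by (simp add: \<sigma>_def \<tau>_def)
          then show ?thesis
            using X[of k] by (simp add: powr_diff powr_divide)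
        qed
        then have "ennreal (X k powr (\<sigma> / \<tau> - \<sigma>)) = ennreal (X k) * (ennreal (X k powr (Q / P - 1)) * ennreal (1 / X k) epowr \<sigma>)"
          using X[of k] by (simp add: ennreal_epowr flip: ennreal_mult)
        then show ?thesis
          using \<tau> unfolding average_eq[OF meas(2) X] by (simp add: epowr_mult_distrib mult_ac)
      qed
      ultimately show ?thesis by (simp only:)
    qed
    have swap: "(\<integral>\<^sup>+x. cube_term \<gamma> Q g (grid_cube k j) * indicator (grid_cube k j) x * ennreal (u x) \<partial>lebesgue)
          = cube_term \<gamma> Q g (grid_cube k j) * (\<integral>\<^sup>+x\<in>grid_cube k j. ennreal (u x) \<partial>lebesgue)"
      for k and j :: "int ^ 'n"
      by (subst nn_integral_cmult[symmetric]) (auto simp: mult_ac intro!: nn_integral_cong)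
    have "(\<integral>\<^sup>+x. grid_sum \<gamma> Q g x * ennreal (u x) \<partial>lebesgue)
        = (\<integral>\<^sup>+x. \<integral>\<^sup>+kj. (case kj of (k, j) \<Rightarrow> cube_term \<gamma> Q g (grid_cube k j) * indicator (grid_cube k j) x * ennreal (u x))
            \<partial>count_space UNIV \<partial>lebesgue)"
      unfolding grid_sum_def
      by (intro nn_integral_cong, subst nn_integral_multc[symmetric]) (auto intro!: nn_integral_cong split: prod.split)
    also have "\<dots> = (\<integral>\<^sup>+kj. \<integral>\<^sup>+x. (case kj of (k, j) \<Rightarrow> cube_term \<gamma> Q g (grid_cube k j) * indicator (grid_cube k j) x * ennreal (u x))
            \<partial>lebesgue \<partial>count_space UNIV)"
      by (rule nn_integral_count_space_nn_integral) (auto split: prod.split)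
    also have "\<dots> = (\<integral>\<^sup>+(k, j). cube_term \<gamma> Q g (grid_cube k j) * (\<integral>\<^sup>+x\<in>grid_cube k j. ennreal (u x) \<partial>lebesgue) \<partial>count_space UNIV)"
      by (intro nn_integral_cong) (simp only: split_def swap)
    also have "\<dots> \<le> (\<integral>\<^sup>+(k, j). ennreal (C powr Q) * (ennreal (X k powr (\<sigma> / \<tau> - \<sigma>)) *
        (\<integral>\<^sup>+y\<in>grid_cube k j. ennreal (H y) \<partial>lebesgue) epowr \<sigma>) \<partial>count_space UNIV)"
      using bound by (intro nn_integral_mono) auto
    also have "\<dots> = ennreal (C powr Q) * (\<integral>\<^sup>+(k, j). ennreal (X k powr (\<sigma> / \<tau> - \<sigma>)) *
        (\<integral>\<^sup>+y\<in>grid_cube k (j :: int ^ 'n). ennreal (H y) \<partial>lebesgue) epowr \<sigma> \<partial>count_space UNIV)"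
      by (subst nn_integral_cmult[symmetric]) (auto intro!: nn_integral_cong split: prod.split)
    also have "\<dots> \<le> ennreal (C powr Q) * (ennreal C1 * (\<integral>\<^sup>+y. ennreal (H y powr \<tau>) \<partial>lebesgue) epowr (\<sigma> / \<tau>))"
      unfolding X_def by (intro mult_left_mono C1 H H0) auto
    also have "\<dots> = ennreal (C powr Q * C1) * (\<integral>\<^sup>+x. ennreal (g x powr P * v x) \<partial>lebesgue) epowr (Q / P)"
      using C1(1) t0 unfolding H\<tau> by (simp add: \<sigma>_def \<tau>_def ennreal_mult mult.assoc)
    finally show "(\<integral>\<^sup>+x. grid_sum \<gamma> Q g x * ennreal (u x) \<partial>lebesgue)
      \<le> ennreal (C powr Q * C1) * (\<integral>\<^sup>+x. ennreal (g x powr P * v x) \<partial>lebesgue) epowr (Q / P)" .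
  qed
qed

subsection \<open>Pointwise domination of the maximal operator\<close>

lemma nn_integral_lborel_reflect:
  fixes f :: "'a::euclidean_space \<Rightarrow> ennreal"
  assumes [measurable]: "f \<in> borel_measurable borel"
  shows "(\<integral>\<^sup>+y. f (x - y) \<partial>lborel) = (\<integral>\<^sup>+y. f y \<partial>lborel)"
proof -
  have "lborel = distr lborel borel (\<lambda>y. x - y)"
    using lborel_affine[of "-1" x] by (simp add: density_1)
  then have "(\<integral>\<^sup>+y. f y \<partial>lborel) = (\<integral>\<^sup>+y. f y \<partial>distr lborel borel (\<lambda>y. x - y))"
    by simp
  also have "\<dots> = (\<integral>\<^sup>+y. f (x - y) \<partial>lborel)"
    by (simp add: nn_integral_distr)
  finally show ?thesis by simp
qed

text \<open>An l2 norm is at most the l1 norm; so the region in the maximal operator lies in the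
  Euclidean ball where the kernel is estimated.\<close>

lemma norm_le_tuple_norm: "norm y \<le> tuple_norm y"
  unfolding tuple_norm_def norm_vec_def[of y] by (rule L2_set_le_sum) simp

lemma norm_nth_le_tuple_norm: "norm (y $ i) \<le> tuple_norm y"
  unfolding tuple_norm_def by (rule member_le_sum) auto

text \<open>For each radius, one grid cube containing the ball about \<open>x\<close> serves all
  components. The kernel estimate leaves the power \<open>- e\<close> of \<open>r\<close>, which is
  comparable to a power of the cube's size and distributes over the \<open>m\<close> averages as
  their fractional factors.\<close>

lemma rough_frac_maximal_le_grid_sums:
  fixes \<Omega> :: "real ^ 'n ^ 'm \<Rightarrow> complex" and \<alpha> s' :: real and q :: "'m \<Rightarrow> real"
  assumes hom: "homogeneous_degree_zero \<Omega>" and L: "in_L_sphere s \<Omega>"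
    and s: "1 < s" "1 / s + 1 / ennreal s' = 1" "1 \<le> s'"
    and \<alpha>: "0 < \<alpha>" "s' < real CARD('m) * real CARD('n) / \<alpha>"
    and q: "\<And>i. 0 < q i"
  obtains c where "0 < c" "\<And>f x. (\<And>i. f i \<in> borel_measurable lebesgue) \<Longrightarrow>
    rough_frac_maximal \<Omega> \<alpha> f x \<le> ennreal c *
      (\<Prod>i\<in>UNIV. grid_sum (\<alpha> * s' / (real CARD('m) * real CARD('n))) (q i / s')
        (\<lambda>y. norm (f i y) powr s') x epowr (1 / q i))"
proof -
  let ?n = "real CARD('n)" and ?m = "real CARD('m)"
  let ?D = "?m * ?n"
  define \<gamma> where "\<gamma> = \<alpha> * s' / ?D"
  define e where "e = ?D / s' - \<alpha>"
  have D: "0 < ?D" by simp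
  have e: "0 < e" using \<alpha> s(3) by (simp add: e_def field_simps)
  have dim: "real DIM(real ^ 'n ^ 'm) = ?D" by simp
  obtain W c where W [measurable]: "W \<in> borel_measurable borel"
    and \<Omega>W: "\<And>y. ennreal (norm (\<Omega> y)) \<le> W y" and c: "0 < (c::real)"
    and Hoelder: "\<And>\<Phi> r. \<Phi> \<in> borel_measurable borel \<Longrightarrow> 0 < r \<Longrightarrow>
       (\<integral>\<^sup>+y\<in>cball 0 r. W y * \<Phi> y \<partial>lborel)
       \<le> ennreal (c * r powr (?D * (1 - 1 / s'))) * (\<integral>\<^sup>+y\<in>cball 0 r. \<Phi> y epowr s' \<partial>lborel) epowr (1 / s')"
    using rough_kernel_Hoelder[OF hom L s] unfolding dim by blast
  show thesis
  proof
    \<comment> \<open>The chosen cube has side \<open>3 * 2 powr k\<close>, at most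
      \<open>6 * r\<close>, so trading \<open>r\<close> for the side costs \<open>6 powr e\<close>,
      as \<open>e\<close> is positive.\<close>
    show "0 < c * 6 powr e" using c by simp
    fix f :: "'m \<Rightarrow> real ^ 'n \<Rightarrow> complex" and x
    assume f [measurable]: "\<And>i. f i \<in> borel_measurable lebesgue"
    have [measurable]: "cball a r \<in> sets borel" "cball a r \<in> sets lebesgue" for a :: "real ^ 'n" and r
      by auto
    \<comment> \<open>Borel majorants make the integrand Borel on tuples; equality almost everywhere
      returns to \<open>f i\<close> once the integral has been split.\<close>
    have "\<exists>F. F \<in> borel_measurable borel \<and> (\<forall>x. ennreal (norm (f i x)) \<le> F x) \<and>
        (AE x in lborel. ennreal (norm (f i x)) = F x)" for i
    proof -
      have "(\<lambda>x. ennreal (norm (f i x))) \<in> borel_measurable (completion lborel)" by measurable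
      then show ?thesis by (rule completion_ex_majorant) auto
    qed
    then obtain F where F [measurable]: "\<And>i. F i \<in> borel_measurable borel"
      and fF: "\<And>i x. ennreal (norm (f i x)) \<le> F i x" and FAE: "\<And>i. AE x in lborel. ennreal (norm (f i x)) = F i x"
      by metis
    let ?g = "\<lambda>i y. norm (f i y) powr s'"
    let ?P = "\<Prod>i\<in>UNIV. grid_sum \<gamma> (q i / s') (?g i) x epowr (1 / q i)"
    have "ennreal (1 / r powr (?D - \<alpha>)) *
        (\<integral>\<^sup>+y\<in>{y. tuple_norm y < r}. ennreal (norm (\<Omega> y) * (\<Prod>i\<in>UNIV. norm (f i (x - y $ i)))) \<partial>lebesgue)
        \<le> ennreal (c * 6 powr e) * ?P" if r: "0 < r" for r
    proof -
      obtain k j where kj: "cball x r \<subseteq> grid_cube k (j :: int ^ 'n)" "2 powr real_of_int k \<le> 2 * r"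
        using cball_subset_grid_cube[OF r] by blast
      let ?R = "grid_cube k j"
      define X where "X = (3 * 2 powr real_of_int k) ^ CARD('n)"
      have X: "0 < X" by (simp add: X_def)
      have meas: "measure lebesgue ?R = X" "emeasure lebesgue ?R = ennreal X"
        by (simp_all only: measure_grid_cube X_def)
      \<comment> \<open>Each component is confined by an indicator of its own, so
        \<open>\<Phi>\<close> is a product over the components.\<close>
      define \<Phi> where "\<Phi> y = (\<Prod>i\<in>UNIV. F i (x - y $ i) * indicator (cball 0 r) (y $ i))" for y :: "real ^ 'n ^ 'm"
      have nth [measurable]: "(\<lambda>y::real^'n^'m. y $ i) \<in> borel_measurable borel" for i
        by (intro borel_measurable_continuous_onI continuous_intros)
      have \<Phi> [measurable]: "\<Phi> \<in> borel_measurable borel"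
        unfolding \<Phi>_def by measurable
      have "(\<integral>\<^sup>+y\<in>{y. tuple_norm y < r}. ennreal (norm (\<Omega> y) * (\<Prod>i\<in>UNIV. norm (f i (x - y $ i)))) \<partial>lebesgue)
          \<le> (\<integral>\<^sup>+y\<in>cball 0 r. W y * \<Phi> y \<partial>lebesgue)"
      proof (rule nn_integral_mono)
        fix y :: "real ^ 'n ^ 'm"
        show "ennreal (norm (\<Omega> y) * (\<Prod>i\<in>UNIV. norm (f i (x - y $ i)))) * indicator {y. tuple_norm y < r} y
          \<le> W y * \<Phi> y * indicator (cball 0 r) y"
        proof (cases "tuple_norm y < r")
          case True
          then have "norm y \<le> r" "\<And>i. norm (y $ i) \<le> r"
            using norm_le_tuple_norm[of y] norm_nth_le_tuple_norm[of y] by (auto intro: order_trans less_imp_le)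
          moreover have "ennreal (norm (\<Omega> y) * (\<Prod>i\<in>UNIV. norm (f i (x - y $ i))))
              \<le> W y * (\<Prod>i\<in>UNIV. F i (x - y $ i))"
          proof -
            have "ennreal (\<Prod>i\<in>UNIV. norm (f i (x - y $ i))) \<le> (\<Prod>i\<in>UNIV. F i (x - y $ i))"
              unfolding prod_ennreal[symmetric, OF norm_ge_zero] using fF by (intro prod_mono_ennreal) auto
            then show ?thesis
              using \<Omega>W[of y] by (simp add: ennreal_mult prod_nonneg mult_mono)
          qed
          ultimately show ?thesis using True by (simp add: \<Phi>_def)
        qed simp
      qed
      also have "\<dots> = (\<integral>\<^sup>+y\<in>cball 0 r. W y * \<Phi> y \<partial>lborel)"
        by (rule nn_integral_completion)
      also have "\<dots> \<le> ennreal (c * r powr (?D * (1 - 1 / s'))) * (\<integral>\<^sup>+y\<in>cball 0 r. \<Phi> y epowr s' \<partial>lborel) epowr (1 / s')"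
        by (rule Hoelder[OF \<Phi> r])
      also have "\<dots> \<le> ennreal (c * r powr (?D * (1 - 1 / s'))) * (\<Prod>i\<in>UNIV. \<integral>\<^sup>+z\<in>?R. ennreal (?g i z) \<partial>lebesgue) epowr (1 / s')"
      proof (intro mult_left_mono epowr_mono)
        \<comment> \<open>The Euclidean ball does not factor and is dropped; the component balls
          inside \<open>\<Phi>\<close> remain.\<close>
        have "(\<integral>\<^sup>+y\<in>cball 0 r. \<Phi> y epowr s' \<partial>lborel) \<le> (\<integral>\<^sup>+y. \<Phi> y epowr s' \<partial>lborel)"
          by (intro nn_integral_mono) (simp add: indicator_def)
        also have "\<dots> = (\<integral>\<^sup>+y. (\<Prod>i\<in>UNIV. (F i (x - y $ i) * indicator (cball 0 r) (y $ i)) epowr s') \<partial>lborel)"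
          using s(3) by (simp add: \<Phi>_def epowr_prod)
        also have "\<dots> = (\<Prod>i\<in>UNIV. \<integral>\<^sup>+z. (F i (x - z) * indicator (cball 0 r) z) epowr s' \<partial>lborel)"
          by (rule nn_integral_lborel_vec_prod) measurable
        also have "\<dots> \<le> (\<Prod>i\<in>UNIV. \<integral>\<^sup>+z\<in>?R. ennreal (?g i z) \<partial>lebesgue)"
        proof (rule prod_mono_ennreal)
          fix i
          have "(\<integral>\<^sup>+z. (F i (x - z) * indicator (cball 0 r) z) epowr s' \<partial>lborel)
              = (\<integral>\<^sup>+z. (F i (x - z) * indicator (cball x r) (x - z)) epowr s' \<partial>lborel)"
            by (intro nn_integral_cong) (auto simp: indicator_def dist_norm)
          also have "\<dots> = (\<integral>\<^sup>+z. (F i z * indicator (cball x r) z) epowr s' \<partial>lborel)"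
            by (rule nn_integral_lborel_reflect) measurable
          also have "\<dots> \<le> (\<integral>\<^sup>+z\<in>?R. ennreal (?g i z) \<partial>lborel)"
          proof (rule nn_integral_mono_AE, use FAE[of i] in eventually_elim)
            fix z assume z: "ennreal (norm (f i z)) = F i z"
            show "(F i z * indicator (cball x r) z) epowr s' \<le> ennreal (?g i z) * indicator ?R z"
              using kj(1) unfolding z[symmetric] by (auto simp: indicator_def ennreal_epowr)
          qed
          finally show "(\<integral>\<^sup>+z. (F i (x - z) * indicator (cball 0 r) z) epowr s' \<partial>lborel)
              \<le> (\<integral>\<^sup>+z\<in>?R. ennreal (?g i z) \<partial>lebesgue)"
            by (simp add: nn_integral_completion)
        qed
        finally show "(\<integral>\<^sup>+y\<in>cball 0 r. \<Phi> y epowr s' \<partial>lborel) \<le> (\<Prod>i\<in>UNIV. \<integral>\<^sup>+z\<in>?R. ennreal (?g i z) \<partial>lebesgue)" .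
      qed (use s(3) in simp_all)
      finally have "ennreal (1 / r powr (?D - \<alpha>)) *
        (\<integral>\<^sup>+y\<in>{y. tuple_norm y < r}. ennreal (norm (\<Omega> y) * (\<Prod>i\<in>UNIV. norm (f i (x - y $ i)))) \<partial>lebesgue)
        \<le> ennreal (1 / r powr (?D - \<alpha>)) * (ennreal (c * r powr (?D * (1 - 1 / s'))) *
          (\<Prod>i\<in>UNIV. \<integral>\<^sup>+z\<in>?R. ennreal (?g i z) \<partial>lebesgue) epowr (1 / s'))"
        by (rule mult_left_mono) simp
      also have "\<dots> = ennreal (c * r powr - e) * (\<Prod>i\<in>UNIV. \<integral>\<^sup>+z\<in>?R. ennreal (?g i z) \<partial>lebesgue) epowr (1 / s')"
      proof -
        have "1 / r powr (?D - \<alpha>) * (c * r powr (?D * (1 - 1 / s'))) = c * (r powr (\<alpha> - ?D) * r powr (?D * (1 - 1 / s')))"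
          using r by (simp add: powr_diff)
        also have "\<dots> = c * r powr - e"
          by (simp add: e_def algebra_simps flip: powr_add)
        finally show ?thesis
          using c r by (simp flip: ennreal_mult mult.assoc)
      qed
      also have "\<dots> \<le> ennreal (c * 6 powr e * X powr (- e / ?n)) * (\<Prod>i\<in>UNIV. \<integral>\<^sup>+z\<in>?R. ennreal (?g i z) \<partial>lebesgue) epowr (1 / s')"
      proof (intro mult_right_mono ennreal_leI)
        have "r powr - e \<le> (2 powr real_of_int k / 2) powr - e"
          using kj(2) r e by (intro powr_mono2') auto
        also have "\<dots> = ((3 * 2 powr real_of_int k) / 6) powr - e" by simp
        also have "\<dots> = 6 powr e * (3 * 2 powr real_of_int k) powr - e"
          by (subst powr_divide) (auto simp: powr_minus_divide)
        also have "(3 * 2 powr real_of_int k) powr - e = X powr (- e / ?n)"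
          unfolding X_def by (subst powr_realpow[symmetric]) (auto simp: powr_powr)
        finally show "c * r powr - e \<le> c * 6 powr e * X powr (- e / ?n)"
          using c by simp
      qed simp
      also have "\<dots> = ennreal (c * 6 powr e) * (\<Prod>i\<in>UNIV. (ennreal (X powr \<gamma>) * average ?R (\<lambda>y. ennreal (?g i y))) epowr (1 / s'))"
      proof -
        \<comment> \<open>Each average contributes the exponent \<open>(\<gamma> - 1) / s'\<close>,
          and \<open>m\<close> of them give \<open>\<alpha> / n - m / s' = - e / n\<close>.\<close>
        have "(\<Prod>i\<in>(UNIV::'m set). (X powr \<gamma> * (1 / X)) powr (1 / s')) = ((X powr (\<gamma> - 1)) powr (1 / s')) powr ?m"
          using X by (simp add: powr_diff powr_realpow)
        also have "\<dots> = X powr (- e / ?n)"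
        proof -
          have "(\<alpha> * s' / (m * n) - 1) * (1 / s') * m = - (m * n / s' - \<alpha>) / n"
            if "0 < m" "0 < n" for m n :: real
            using that s(3) by (simp add: field_simps)
          from this[of ?m ?n] show ?thesis by (simp only: powr_powr \<gamma>_def e_def) simp
        qed
        finally have "ennreal (X powr (- e / ?n)) = (\<Prod>i\<in>(UNIV::'m set). (ennreal (X powr \<gamma>) * ennreal (1 / X)) epowr (1 / s'))"
          using X by (simp add: ennreal_epowr ennreal_power flip: ennreal_mult)
        then have "ennreal (c * 6 powr e * X powr (- e / ?n))
          = ennreal (c * 6 powr e) * (\<Prod>i\<in>(UNIV::'m set). (ennreal (X powr \<gamma>) * ennreal (1 / X)) epowr (1 / s'))"
          using c by (simp add: ennreal_mult)
        moreover have "(\<Prod>i\<in>UNIV. \<integral>\<^sup>+z\<in>?R. ennreal (?g i z) \<partial>lebesgue) epowr (1 / s')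
            = (\<Prod>i\<in>UNIV. (\<integral>\<^sup>+z\<in>?R. ennreal (?g i z) \<partial>lebesgue) epowr (1 / s'))"
          using s(3) by (intro epowr_prod) simp
        ultimately show ?thesis
          unfolding average_eq[OF meas(2) X] using s(3)
          by (simp only: mult.assoc prod.distrib[symmetric]) (simp add: epowr_mult_distrib mult.assoc)
      qed
      also have "\<dots> \<le> ennreal (c * 6 powr e) * ?P"
      proof (intro mult_left_mono prod_mono_ennreal)
        fix i
        have xR: "x \<in> ?R" using kj(1) r by auto
        have "(ennreal (X powr \<gamma>) * average ?R (\<lambda>y. ennreal (?g i y))) epowr (1 / s')
            = ((ennreal (X powr \<gamma>) * average ?R (\<lambda>y. ennreal (?g i y))) epowr (q i / s')) epowr (1 / q i)"
          using q[of i] by (simp add: epowr_epowr)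
        also have "\<dots> \<le> grid_sum \<gamma> (q i / s') (?g i) x epowr (1 / q i)"
          using grid_sum_ge[OF xR, where \<gamma> = \<gamma> and Q = "q i / s'" and g = "?g i"] q[of i] unfolding meas(1)
          by (intro epowr_mono) auto
        finally show "(ennreal (X powr \<gamma>) * average ?R (\<lambda>y. ennreal (?g i y))) epowr (1 / s')
            \<le> grid_sum \<gamma> (q i / s') (?g i) x epowr (1 / q i)" .
      qed auto
      finally show ?thesis .
    qed
    then show "rough_frac_maximal \<Omega> \<alpha> f x \<le> ennreal (c * 6 powr e) *
      (\<Prod>i\<in>UNIV. grid_sum (\<alpha> * s' / ?D) (q i / s') (?g i) x epowr (1 / q i))"
      unfolding rough_frac_maximal_def \<gamma>_def by (intro SUP_least) auto
  qed
qed

subsection \<open>The two-weight inequality\<close>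

theorem theorem5:
  fixes \<Omega> :: "real ^ 'n ^ 'm \<Rightarrow> complex"
    and u v :: "real ^ 'n \<Rightarrow> real"
    and p q :: "'m \<Rightarrow> real"
    and \<alpha> s' p0 :: real
    and s :: ennreal
  assumes "2 \<le> CARD('n)"
    and "0 < \<alpha>" "\<alpha> < real CARD('m) * real CARD('n)"
    and "1 < s" "1 / s + 1 / ennreal s' = 1"
    and "1 \<le> s'" "s' < real CARD('m) * real CARD('n) / \<alpha>"
    and "homogeneous_degree_zero \<Omega>" "in_L_sphere s \<Omega>"
    and "weight u" "weight v"
    and "\<And>i. s' < p i" "\<And>i. p i < q i"
    and "1 / p0 = (\<Sum>i\<in>UNIV. 1 / q i)"
    and "\<And>i. \<exists>r>1. \<exists>C>0. \<forall>Q. cube Q \<longrightarrow>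
           ennreal (measure lebesgue Q powr
              (s' / q i + \<alpha> * s' / (real CARD('m) * real CARD('n)) - s' / p i)) *
           average Q (\<lambda>x. ennreal (u x)) epowr (s' / q i) *
           average Q (\<lambda>x. ennreal (v x powr (r * (1 - conj_exp (p i / s')))))
             epowr (1 / (r * conj_exp (p i / s')))
           \<le> ennreal C"
  shows "\<exists>C>0. \<forall>f. (\<forall>i. f i \<in> Lp_space v (p i)) \<longrightarrow>
           Lp_norm u p0 (rough_frac_maximal \<Omega> \<alpha> f)
           \<le> ennreal C * (\<Prod>i\<in>UNIV. Lp_norm v (p i) (\<lambda>x. ennreal (norm (f i x))))"
proof -
  have s': "0 < s'" using assms(6) by simp
  have p: "0 < p i" and q: "0 < q i" for i
    using s' assms(12)[of i] assms(13)[of i] by linarith+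
  have "0 < (\<Sum>i\<in>UNIV. 1 / q i)" using q by (intro sum_pos) auto
  then have p0: "0 < p0" using assms(14) by (metis zero_less_divide_1_iff)
  \<comment> \<open>These ratios serve as Hoelder exponents for the measure
    \<open>u dx\<close>.\<close>
  have w: "(\<Sum>i\<in>UNIV. p0 / q i) = 1"
  proof -
    have "(\<Sum>i\<in>UNIV. p0 / q i) = p0 * (\<Sum>i\<in>UNIV. 1 / q i)"
      by (simp add: sum_distrib_left)
    then show ?thesis using p0 assms(14)[symmetric] by simp
  qed
  note [measurable] = weight_measurable[OF assms(10)] weight_measurable[OF assms(11)]
  define \<gamma> where "\<gamma> = \<alpha> * s' / (real CARD('m) * real CARD('n))"
  obtain c where c: "0 < c" "\<And>f x. (\<And>i. f i \<in> borel_measurable lebesgue) \<Longrightarrow>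
    rough_frac_maximal \<Omega> \<alpha> f x \<le> ennreal c *
      (\<Prod>i\<in>UNIV. grid_sum \<gamma> (q i / s') (\<lambda>y. norm (f i y) powr s') x epowr (1 / q i))"
    unfolding \<gamma>_def by (rule rough_frac_maximal_le_grid_sums[where q = q, OF assms(8,9,4,5,6,2,7) q]) blast
  \<comment> \<open>The two-weight estimate with \<open>P = p i / s'\<close> and
    \<open>Q = q i / s'\<close>, to be applied to \<open>g = |f i| powr s'\<close>; the constant
    depends on \<open>i\<close> but not on \<open>g\<close>.\<close>
  have "\<exists>C>0. \<forall>g. g \<in> borel_measurable lebesgue \<longrightarrow> (\<forall>y. 0 \<le> g y) \<longrightarrow>
    (\<integral>\<^sup>+x. grid_sum \<gamma> (q i / s') g x * ennreal (u x) \<partial>lebesgue)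
    \<le> ennreal C * (\<integral>\<^sup>+x. ennreal (g x powr (p i / s') * v x) \<partial>lebesgue) epowr (q i / p i)" for i
  proof -
    obtain r C where rC: "1 < r" "0 < C" "\<And>R. cube R \<Longrightarrow>
      ennreal (measure lebesgue R powr (1 / (q i / s') + \<gamma> - 1 / (p i / s'))) * average R (\<lambda>x. ennreal (u x)) epowr (1 / (q i / s')) *
      average R (\<lambda>x. ennreal (v x powr (r * (1 - conj_exp (p i / s'))))) epowr (1 / (r * conj_exp (p i / s'))) \<le> ennreal C"
      using assms(15)[of i] unfolding \<gamma>_def by auto
    have PQ: "1 < p i / s'" "p i / s' < q i / s'"
      using s' assms(12)[of i] assms(13)[of i] by (auto simp: divide_strict_right_mono)
    show ?thesis
    proof (rule grid_sum_two_weight[OF assms(10,11) PQ rC])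
      fix C'
      assume "0 < C'" and "\<And>g. g \<in> borel_measurable lebesgue \<Longrightarrow> (\<And>y. 0 \<le> g y) \<Longrightarrow>
        (\<integral>\<^sup>+x. grid_sum \<gamma> (q i / s') g x * ennreal (u x) \<partial>lebesgue)
        \<le> ennreal C' * (\<integral>\<^sup>+x. ennreal (g x powr (p i / s') * v x) \<partial>lebesgue) epowr (q i / s' / (p i / s'))"
      then show ?thesis using s' by (intro exI[of _ C']) simp
    qed
  qed
  then have "\<exists>C. \<forall>i. 0 < C i \<and> (\<forall>g. g \<in> borel_measurable lebesgue \<longrightarrow> (\<forall>y. 0 \<le> g y) \<longrightarrow>
    (\<integral>\<^sup>+x. grid_sum \<gamma> (q i / s') g x * ennreal (u x) \<partial>lebesgue)
    \<le> ennreal (C i) * (\<integral>\<^sup>+x. ennreal (g x powr (p i / s') * v x) \<partial>lebesgue) epowr (q i / p i))"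
    by (intro choice allI)
  then obtain C where C: "\<And>i. 0 < C i"
    "\<And>i g. g \<in> borel_measurable lebesgue \<Longrightarrow> (\<And>y. 0 \<le> g y) \<Longrightarrow>
    (\<integral>\<^sup>+x. grid_sum \<gamma> (q i / s') g x * ennreal (u x) \<partial>lebesgue)
    \<le> ennreal (C i) * (\<integral>\<^sup>+x. ennreal (g x powr (p i / s') * v x) \<partial>lebesgue) epowr (q i / p i)"
    by blast
  show ?thesis
  proof (intro exI conjI allI impI)
    show "0 < c * (\<Prod>i\<in>UNIV. C i powr (1 / q i))"
      using c(1) C(1) by (intro mult_pos_pos prod_pos) (auto simp: less_imp_neq[symmetric])
    fix f :: "'m \<Rightarrow> real ^ 'n \<Rightarrow> complex"
    assume "\<forall>i. f i \<in> Lp_space v (p i)"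
    then have f [measurable]: "\<And>i. f i \<in> borel_measurable lebesgue" by (auto simp: Lp_space_def)
    let ?G = "\<lambda>i. grid_sum \<gamma> (q i / s') (\<lambda>y. norm (f i y) powr s')"
    let ?I = "\<lambda>i. \<integral>\<^sup>+x. ?G i x * ennreal (u x) \<partial>lebesgue"
    let ?N = "\<lambda>i. Lp_norm v (p i) (\<lambda>x. ennreal (norm (f i x)))"
    have I_le: "?I i epowr (1 / q i) \<le> ennreal (C i powr (1 / q i)) * ?N i" for i
    proof -
      \<comment> \<open>The exponents \<open>s'\<close> and \<open>p i / s'\<close> combine to
        \<open>p i\<close>; the later power \<open>(q i / p i) * (1 / q i) = 1 / p i\<close>
        completes the norm.\<close>
      have "(\<integral>\<^sup>+x. ennreal ((norm (f i x) powr s') powr (p i / s') * v x) \<partial>lebesgue)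
          = (\<integral>\<^sup>+x. ennreal (norm (f i x)) epowr p i * ennreal (v x) \<partial>lebesgue)"
        using s' assms(11) by (intro nn_integral_cong) (simp add: powr_powr ennreal_epowr ennreal_mult weight_def)
      then have "?I i \<le> ennreal (C i) * (\<integral>\<^sup>+x. ennreal (norm (f i x)) epowr p i * ennreal (v x) \<partial>lebesgue) epowr (q i / p i)"
        using C(2)[of "\<lambda>y. norm (f i y) powr s'" i] by simp
      then have "?I i epowr (1 / q i) \<le> (ennreal (C i) * (\<integral>\<^sup>+x. ennreal (norm (f i x)) epowr p i * ennreal (v x) \<partial>lebesgue) epowr (q i / p i)) epowr (1 / q i)"
        using q[of i] by (intro epowr_mono) auto
      also have "\<dots> = ennreal (C i powr (1 / q i)) * ?N i"
        using q[of i] C(1)[of i]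
        by (simp add: epowr_mult_distrib epowr_epowr ennreal_epowr Lp_norm_def less_imp_le)
      finally show ?thesis .
    qed
    have "(\<integral>\<^sup>+x. rough_frac_maximal \<Omega> \<alpha> f x epowr p0 * ennreal (u x) \<partial>lebesgue)
        \<le> (\<integral>\<^sup>+x. ennreal (c powr p0) * (ennreal (u x) * (\<Prod>i\<in>UNIV. ?G i x epowr (p0 / q i))) \<partial>lebesgue)"
    proof (rule nn_integral_mono)
      fix x
      have "rough_frac_maximal \<Omega> \<alpha> f x epowr p0 \<le> (ennreal c * (\<Prod>i\<in>UNIV. ?G i x epowr (1 / q i))) epowr p0"
        using p0 by (intro epowr_mono c(2)) auto
      also have "\<dots> = ennreal (c powr p0) * (\<Prod>i\<in>UNIV. ?G i x epowr (p0 / q i))"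
        using p0 c(1) by (simp add: epowr_mult_distrib epowr_prod epowr_epowr ennreal_epowr)
      finally have "rough_frac_maximal \<Omega> \<alpha> f x epowr p0 * ennreal (u x)
          \<le> ennreal (c powr p0) * (\<Prod>i\<in>UNIV. ?G i x epowr (p0 / q i)) * ennreal (u x)"
        by (rule mult_right_mono) simp
      then show "rough_frac_maximal \<Omega> \<alpha> f x epowr p0 * ennreal (u x)
          \<le> ennreal (c powr p0) * (ennreal (u x) * (\<Prod>i\<in>UNIV. ?G i x epowr (p0 / q i)))"
        by (simp only: mult_ac)
    qed
    \<comment> \<open>Moving \<open>u\<close> into the measure leaves a pure product of grid sums,
      to which Hoelder's inequality applies.\<close>
    also have "\<dots> = ennreal (c powr p0) * (\<integral>\<^sup>+x. (\<Prod>i\<in>UNIV. ?G i x epowr (p0 / q i)) \<partial>density lebesgue (\<lambda>x. ennreal (u x)))"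
      by (simp add: nn_integral_cmult nn_integral_density)
    also have "\<dots> \<le> ennreal (c powr p0) * (\<Prod>i\<in>UNIV. (\<integral>\<^sup>+x. ?G i x \<partial>density lebesgue (\<lambda>x. ennreal (u x))) epowr (p0 / q i))"
      using p0 q w by (intro mult_left_mono nn_integral_prod_epowr_le) auto
    also have "\<dots> = ennreal (c powr p0) * (\<Prod>i\<in>UNIV. ?I i epowr (p0 / q i))"
      by (simp add: nn_integral_density mult.commute)
    finally have "Lp_norm u p0 (rough_frac_maximal \<Omega> \<alpha> f) \<le> (ennreal (c powr p0) * (\<Prod>i\<in>UNIV. ?I i epowr (p0 / q i))) epowr (1 / p0)"
      unfolding Lp_norm_def using p0 by (intro epowr_mono) auto
    also have "\<dots> = ennreal c * (\<Prod>i\<in>UNIV. ?I i epowr (1 / q i))"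
      using p0 c(1) by (simp add: epowr_mult_distrib epowr_prod epowr_epowr ennreal_epowr powr_powr)
    also have "\<dots> \<le> ennreal c * (\<Prod>i\<in>UNIV. ennreal (C i powr (1 / q i)) * ?N i)"
      by (intro mult_left_mono prod_mono_ennreal I_le) auto
    also have "\<dots> = ennreal (c * (\<Prod>i\<in>UNIV. C i powr (1 / q i))) * (\<Prod>i\<in>UNIV. ?N i)"
      using c(1) by (simp add: prod.distrib ennreal_mult prod_nonneg mult.assoc prod_ennreal)
    finally show "Lp_norm u p0 (rough_frac_maximal \<Omega> \<alpha> f)
        \<le> ennreal (c * (\<Prod>i\<in>UNIV. C i powr (1 / q i))) * (\<Prod>i\<in>UNIV. ?N i)" .
  qed
qed

end
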